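(* Let $(\Phi_n,\{\Pi_i\}_{i\in\Phi_n})$ be a finite t-stability on a triangulated category $\mathcal{D}$. For every $i\in\Phi_n$, assume $(I_i,\{P_\psi\}_{\psi\in I_i})$ is a finite t-stability on the triangulated category $\Pi_i$. Let $\Psi=\bigcup_{i\in\Phi_n}I_i$, a linearly ordered set containing each $I_i$ as a linearly ordered subset and such that $\psi_{i_2}>\psi_{i_1}$ whenever $\psi_{i_1}\in I_{i_1}$, $\psi_{i_2}\in I_{i_2}$ with $i_2>i_1$. Then $(\Psi,\{P_\psi\}_{\psi\in\Psi})$ with $\tau_\Psi=\mathrm{id}$ is a finite t-stability on $\mathcal{D}$, which is finer than $(\Phi_n,\{\Pi_i\}_{i\in\Phi_n})$.
   Context: All categories are $\mathbf{k}$-linear over a fixed algebraically closed field $\mathbf{k}$. $\Phi_n=\{1<2<\dots<n\}$. For a set $\mathcal{S}$ of objects (or a family of subcategories) of $\mathcal{D}$, $\langle\mathcal{S}\rangle$ is the full triangulated subcategory of $\mathcal{D}$ generated by $\mathcal{S}$, closed under extensions, direct summands and shifts. t-stability on a triangulated category $\mathcal{D}$: a linearly ordered set $\Phi$ together with a strictly full extension-closed nonzero subcategory $\Pi_\varphi\subset\mathcal{D}$ for every $\varphi\in\Phi$, such that (1) there is an order automorphism $\tau_\Phi$ of $\Phi$ with $\Pi_{\tau_\Phi(\varphi)}=\Pi_\varphi[1]$ and $\tau_\Phi(\varphi)\ge\varphi$ for all $\varphi$; (2) $\mathrm{Hom}^{\le0}(\Pi_{\varphi'},\Pi_{\varphi''})=0$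 for all $\varphi'>\varphi''$; (3) every nonzero $X\in\mathcal{D}$ admits a finite sequence of morphisms $0=X_n\xrightarrow{p_n}X_{n-1}\to\dots\xrightarrow{p_1}X_0=X$ with nonzero cones $A_i=\mathrm{cone}(p_i)\in\Pi_{\varphi_i}$ and $\varphi_{i+1}>\varphi_i$ for all $i$. It is finite if $\Phi$ is finite; then necessarily $\tau_\Phi=\mathrm{id}$, so each $\Pi_\varphi$ is a triangulated subcategory. Finer: a finite t-stability $(\Psi,\{P_\psi\})$ is finer than $(\Phi,\{\Pi_\varphi\})$ if there is a surjective map $r:\Psi\to\Phi$ with $r\tau_\Psi=\tau_\Phi r$, $\psi'>\psi''\Rightarrow r(\psi')\ge r(\psi'')$, and $\Pi_\varphi=\langle P_\psi\mid\psi\in r^{-1}(\varphi)\rangle$ for all $\varphi\in\Phi$. *)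

theory Defs
  imports "HOL-Algebra.Algebra"
begin

section \<open>Linear and triangulated categories\<close>

text \<open>
  The data of a triangulated category. Every arrow has one domain and one codomain, so the
  Hom sets are pairwise disjoint. \<open>Comp C g f\<close> is the composite \<open>g \<circ> f\<close>; \<open>Add\<close> is only
  meaningful on parallel arrows; \<open>ShO\<close> and \<open>ShA\<close> are the shift functor \<open>[1]\<close> on objects and
  arrows; \<open>Tri\<close> is the set of distinguished triangles, the triple \<open>(f, g, h)\<close> standing for
  \<open>x \<rightarrow> y \<rightarrow> z \<rightarrow> x[1]\<close>.
\<close>

record ('o, 'm, 'k) tricat =
  Obj :: "'o set"
  Arr :: "'m set"
  Dom :: "'m \<Rightarrow> 'o"
  Cod :: "'m \<Rightarrow> 'o"
  Ident :: "'o \<Rightarrow> 'm"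
  Comp :: "'m \<Rightarrow> 'm \<Rightarrow> 'm"
  Zero :: "'o \<Rightarrow> 'o \<Rightarrow> 'm"
  Add :: "'m \<Rightarrow> 'm \<Rightarrow> 'm"
  Smult :: "'k \<Rightarrow> 'm \<Rightarrow> 'm"
  ShO :: "'o \<Rightarrow> 'o"
  ShA :: "'m \<Rightarrow> 'm"
  Tri :: "('m \<times> 'm \<times> 'm) set"

definition Mor :: "('o, 'm, 'k) tricat \<Rightarrow> 'o \<Rightarrow> 'o \<Rightarrow> 'm set" where
  "Mor C x y = {f \<in> Arr C. Dom C f = x \<and> Cod C f = y}"

text \<open>The multiplicative components of the record are irrelevant for modules.\<close>

definition Mor_space :: "('o, 'm, 'k) tricat \<Rightarrow> 'o \<Rightarrow> 'o \<Rightarrow> ('k, 'm) module" where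
  "Mor_space C x y =
     \<lparr>carrier = Mor C x y, monoid.mult = undefined, one = undefined,
      ring.zero = Zero C x y, ring.add = Add C, module.smult = Smult C\<rparr>"

definition isomorphism :: "('o, 'm, 'k) tricat \<Rightarrow> 'm \<Rightarrow> bool" where
  "isomorphism C f \<longleftrightarrow> f \<in> Arr C \<and>
     (\<exists>g \<in> Mor C (Cod C f) (Dom C f).
        Comp C g f = Ident C (Dom C f) \<and> Comp C f g = Ident C (Cod C f))"

definition isomorphic :: "('o, 'm, 'k) tricat \<Rightarrow> 'o \<Rightarrow> 'o \<Rightarrow> bool" where
  "isomorphic C x y \<longleftrightarrow> (\<exists>f \<in> Mor C x y. isomorphism C f)"

definition zero_object :: "('o, 'm, 'k) tricat \<Rightarrow> 'o \<Rightarrow> bool" where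
  "zero_object C z \<longleftrightarrow> z \<in> Obj C \<and>
     (\<forall>x \<in> Obj C. (\<exists>!f. f \<in> Mor C x z) \<and> (\<exists>!f. f \<in> Mor C z x))"

definition biproduct ::
  "('o, 'm, 'k) tricat \<Rightarrow> 'o \<Rightarrow> 'o \<Rightarrow> 'o \<Rightarrow> bool" where
  "biproduct C x y S \<longleftrightarrow> x \<in> Obj C \<and> y \<in> Obj C \<and> S \<in> Obj C \<and>
     (\<exists>i \<in> Mor C x S. \<exists>j \<in> Mor C y S. \<exists>p \<in> Mor C S x. \<exists>q \<in> Mor C S y.
        Comp C p i = Ident C x \<and> Comp C q j = Ident C y \<and>
        Comp C p j = Zero C y x \<and> Comp C q i = Zero C x y \<and>
        Add C (Comp C i p) (Comp C j q) = Ident C S)"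

locale category =
  fixes C :: "('o, 'm, 'k) tricat"
  assumes Dom_closed: "f \<in> Arr C \<Longrightarrow> Dom C f \<in> Obj C"
    and Cod_closed: "f \<in> Arr C \<Longrightarrow> Cod C f \<in> Obj C"
    and Ident_closed: "x \<in> Obj C \<Longrightarrow> Ident C x \<in> Mor C x x"
    and Comp_closed: "f \<in> Mor C x y \<Longrightarrow> g \<in> Mor C y z \<Longrightarrow> Comp C g f \<in> Mor C x z"
    and Comp_Ident: "f \<in> Mor C x y \<Longrightarrow> Comp C f (Ident C x) = f"
    and Ident_Comp: "f \<in> Mor C x y \<Longrightarrow> Comp C (Ident C y) f = f"
    and Comp_assoc: "f \<in> Mor C x y \<Longrightarrow> g \<in> Mor C y z \<Longrightarrow> h \<in> Mor C z w \<Longrightarrow>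
      Comp C h (Comp C g f) = Comp C (Comp C h g) f"

locale linear_category = category C + K: field K
  for K :: "('k, 'e) ring_scheme" and C :: "('o, 'm, 'k) tricat" +
  assumes Mor_module: "x \<in> Obj C \<Longrightarrow> y \<in> Obj C \<Longrightarrow> module K (Mor_space C x y)"
    and Comp_Add_right: "f \<in> Mor C x y \<Longrightarrow> f' \<in> Mor C x y \<Longrightarrow> g \<in> Mor C y z \<Longrightarrow>
      Comp C g (Add C f f') = Add C (Comp C g f) (Comp C g f')"
    and Comp_Add_left: "f \<in> Mor C x y \<Longrightarrow> g \<in> Mor C y z \<Longrightarrow> g' \<in> Mor C y z \<Longrightarrow>
      Comp C (Add C g g') f = Add C (Comp C g f) (Comp C g' f)"
    and Comp_Smult_right: "s \<in> carrier K \<Longrightarrow> f \<in> Mor C x y \<Longrightarrow> g \<in> Mor C y z \<Longrightarrow>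
      Comp C g (Smult C s f) = Smult C s (Comp C g f)"
    and Comp_Smult_left: "s \<in> carrier K \<Longrightarrow> f \<in> Mor C x y \<Longrightarrow> g \<in> Mor C y z \<Longrightarrow>
      Comp C (Smult C s g) f = Smult C s (Comp C g f)"

locale additive_linear_category = linear_category K C
  for K :: "('k, 'e) ring_scheme" and C :: "('o, 'm, 'k) tricat" +
  assumes zero_object_exists: "\<exists>z. zero_object C z"
    and biproduct_exists: "x \<in> Obj C \<Longrightarrow> y \<in> Obj C \<Longrightarrow> \<exists>S. biproduct C x y S"

definition triangle_shape :: "('o, 'm, 'k) tricat \<Rightarrow> 'm \<Rightarrow> 'm \<Rightarrow> 'm \<Rightarrow> bool" where
  "triangle_shape C f g h \<longleftrightarrow> f \<in> Arr C \<and> g \<in> Arr C \<and> h \<in> Arr C \<and>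
     Cod C f = Dom C g \<and> Cod C g = Dom C h \<and> Cod C h = ShO C (Dom C f)"

definition triangle_morphism ::
  "('o, 'm, 'k) tricat \<Rightarrow> 'm \<times> 'm \<times> 'm \<Rightarrow> 'm \<times> 'm \<times> 'm \<Rightarrow> 'm \<Rightarrow> 'm \<Rightarrow> 'm \<Rightarrow> bool" where
  "triangle_morphism C = (\<lambda>(f, g, h) (f', g', h') u v w.
     u \<in> Mor C (Dom C f) (Dom C f') \<and>
     v \<in> Mor C (Dom C g) (Dom C g') \<and>
     w \<in> Mor C (Dom C h) (Dom C h') \<and>
     Comp C v f = Comp C f' u \<and>
     Comp C w g = Comp C g' v \<and>
     Comp C (ShA C u) h = Comp C h' w)"

text \<open>
  The shift is a linear autoequivalence (in particular it may be an automorphism). The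
  axioms of Verdier follow; the last one is the octahedral axiom for the composite \<open>g \<circ> f\<close>
  of \<open>f : x \<rightarrow> y\<close> and \<open>g : y \<rightarrow> z\<close>, with chosen cones \<open>z'\<close> of \<open>f\<close>, \<open>y'\<close> of \<open>g \<circ> f\<close> and \<open>x'\<close>
  of \<open>g\<close>.
\<close>

locale triangulated_category = additive_linear_category K C
  for K :: "('k, 'e) ring_scheme" and C :: "('o, 'm, 'k) tricat" +
  assumes ShO_closed: "x \<in> Obj C \<Longrightarrow> ShO C x \<in> Obj C"
    and ShA_Ident: "x \<in> Obj C \<Longrightarrow> ShA C (Ident C x) = Ident C (ShO C x)"
    and ShA_Comp: "f \<in> Mor C x y \<Longrightarrow> g \<in> Mor C y z \<Longrightarrow>
      ShA C (Comp C g f) = Comp C (ShA C g) (ShA C f)"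
    and ShA_Add: "f \<in> Mor C x y \<Longrightarrow> f' \<in> Mor C x y \<Longrightarrow>
      ShA C (Add C f f') = Add C (ShA C f) (ShA C f')"
    and ShA_Smult: "s \<in> carrier K \<Longrightarrow> f \<in> Mor C x y \<Longrightarrow>
      ShA C (Smult C s f) = Smult C s (ShA C f)"
    and ShA_bij: "x \<in> Obj C \<Longrightarrow> y \<in> Obj C \<Longrightarrow>
      bij_betw (ShA C) (Mor C x y) (Mor C (ShO C x) (ShO C y))"
    and ShO_ess_surj: "y \<in> Obj C \<Longrightarrow> \<exists>x \<in> Obj C. isomorphic C (ShO C x) y"
    and Tri_shape: "(f, g, h) \<in> Tri C \<Longrightarrow> triangle_shape C f g h"
    and Tri_iso_closed: "(f, g, h) \<in> Tri C \<Longrightarrow> triangle_shape C f' g' h' \<Longrightarrow>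
      triangle_morphism C (f, g, h) (f', g', h') u v w \<Longrightarrow>
      isomorphism C u \<Longrightarrow> isomorphism C v \<Longrightarrow> isomorphism C w \<Longrightarrow> (f', g', h') \<in> Tri C"
    and Tri_Ident: "x \<in> Obj C \<Longrightarrow> zero_object C z \<Longrightarrow>
      (Ident C x, Zero C x z, Zero C z (ShO C x)) \<in> Tri C"
    and Tri_complete: "f \<in> Arr C \<Longrightarrow> \<exists>g h. (f, g, h) \<in> Tri C"
    and Tri_rotate: "triangle_shape C f g h \<Longrightarrow>
      (f, g, h) \<in> Tri C \<longleftrightarrow>
      (g, h, \<ominus>\<^bsub>Mor_space C (ShO C (Dom C f)) (ShO C (Cod C f))\<^esub> ShA C f) \<in> Tri C"
    and Tri_fill: "(f, g, h) \<in> Tri C \<Longrightarrow> (f', g', h') \<in> Tri C \<Longrightarrow>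
      u \<in> Mor C (Dom C f) (Dom C f') \<Longrightarrow> v \<in> Mor C (Cod C f) (Cod C f') \<Longrightarrow>
      Comp C v f = Comp C f' u \<Longrightarrow>
      \<exists>w. triangle_morphism C (f, g, h) (f', g', h') u v w"
    and Tri_octahedral: "f \<in> Mor C x y \<Longrightarrow> g \<in> Mor C y z \<Longrightarrow>
      (f, a, a') \<in> Tri C \<Longrightarrow> (Comp C g f, b, b') \<in> Tri C \<Longrightarrow> (g, c, c') \<in> Tri C \<Longrightarrow>
      \<exists>u v. (u, v, Comp C (ShA C a) c') \<in> Tri C \<and>
        u \<in> Mor C (Cod C a) (Cod C b) \<and> v \<in> Mor C (Cod C b) (Cod C c) \<and>
        Comp C u a = Comp C b g \<and> Comp C b' u = a' \<and>
        Comp C v b = c \<and> Comp C c' v = Comp C (ShA C f) b'"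


section \<open>Full subcategories\<close>

text \<open>Full subcategories are represented by their sets of objects.\<close>

definition strictly_full :: "('o, 'm, 'k) tricat \<Rightarrow> 'o set \<Rightarrow> bool" where
  "strictly_full C S \<longleftrightarrow> S \<subseteq> Obj C \<and> (\<forall>x \<in> S. \<forall>y \<in> Obj C. isomorphic C x y \<longrightarrow> y \<in> S)"

definition extension_closed :: "('o, 'm, 'k) tricat \<Rightarrow> 'o set \<Rightarrow> bool" where
  "extension_closed C S \<longleftrightarrow>
     (\<forall>f g h. (f, g, h) \<in> Tri C \<longrightarrow> Dom C f \<in> S \<longrightarrow> Cod C g \<in> S \<longrightarrow> Cod C f \<in> S)"

definition nonzero_subcategory :: "('o, 'm, 'k) tricat \<Rightarrow> 'o set \<Rightarrow> bool" where
  "nonzero_subcategory C S \<longleftrightarrow> (\<exists>x \<in> S. \<not> zero_object C x)"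

text \<open>\<open>S[1]\<close> as a strictly full subcategory, i.e. closed under isomorphism.\<close>

definition shift_subcategory :: "('o, 'm, 'k) tricat \<Rightarrow> 'o set \<Rightarrow> 'o set" where
  "shift_subcategory C S = {y \<in> Obj C. \<exists>x \<in> S. isomorphic C (ShO C x) y}"

text \<open>The full subcategory on \<open>S\<close> with the induced shift and distinguished triangles.\<close>

definition full_subcategory ::
  "('o, 'm, 'k) tricat \<Rightarrow> 'o set \<Rightarrow> ('o, 'm, 'k) tricat" where
  "full_subcategory C S = C
     \<lparr>Obj := S,
      Arr := {f \<in> Arr C. Dom C f \<in> S \<and> Cod C f \<in> S},
      Tri := {(f, g, h) \<in> Tri C. \<forall>k \<in> {f, g, h}. Dom C k \<in> S \<and> Cod C k \<in> S}\<rparr>"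

definition triangulated_subcategory :: "('o, 'm, 'k) tricat \<Rightarrow> 'o set \<Rightarrow> bool" where
  "triangulated_subcategory C S \<longleftrightarrow> strictly_full C S \<and>
     (\<exists>z \<in> S. zero_object C z) \<and>
     (\<forall>x \<in> Obj C. x \<in> S \<longleftrightarrow> ShO C x \<in> S) \<and>
     extension_closed C S"

definition summand_closed :: "('o, 'm, 'k) tricat \<Rightarrow> 'o set \<Rightarrow> bool" where
  "summand_closed C S \<longleftrightarrow> (\<forall>x y z. biproduct C x y z \<longrightarrow> z \<in> S \<longrightarrow> x \<in> S)"

definition generated_subcategory :: "('o, 'm, 'k) tricat \<Rightarrow> 'o set \<Rightarrow> 'o set" where
  "generated_subcategory C S =
     \<Inter> {T. triangulated_subcategory C T \<and> summand_closed C T \<and> S \<subseteq> T}"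


section \<open>t-stabilities\<close>

text \<open>
  \<open>Hom\<^sup>k(x, y)\<close> is \<open>Hom(x, y[k])\<close>; as \<open>[1]\<close> need not be strictly invertible,
  it is written \<open>Hom(x[-k], y)\<close> for negative \<open>k\<close>.
\<close>

definition graded_Mor ::
  "('o, 'm, 'k) tricat \<Rightarrow> int \<Rightarrow> 'o \<Rightarrow> 'o \<Rightarrow> 'm set" where
  "graded_Mor C k x y =
     (if 0 \<le> k then Mor C x ((ShO C ^^ nat k) y) else Mor C ((ShO C ^^ nat (- k)) x) y)"

definition nonpos_Mor_vanish :: "('o, 'm, 'k) tricat \<Rightarrow> 'o set \<Rightarrow> 'o set \<Rightarrow> bool" where
  "nonpos_Mor_vanish C S T \<longleftrightarrow>
     (\<forall>x \<in> S. \<forall>y \<in> T. \<forall>k \<le> 0. \<forall>f \<in> graded_Mor C k x y. f = Zero C (Dom C f) (Cod C f))"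

definition is_cone :: "('o, 'm, 'k) tricat \<Rightarrow> 'm \<Rightarrow> 'o \<Rightarrow> bool" where
  "is_cone C f A \<longleftrightarrow> (\<exists>g h. (f, g, h) \<in> Tri C \<and> Cod C g = A)"

text \<open>
  The linearly ordered set is the index set \<open>Idx\<close> with the (reflexive) order relation \<open>Ord\<close>;
  \<open>Part\<close> is the family of subcategories, \<open>Tau\<close> the order automorphism. \<open>Part\<close> and \<open>Tau\<close> are
  only relevant on \<open>Idx\<close>.
\<close>

record ('i, 'o) stability_data =
  Idx :: "'i set"
  Ord :: "'i rel"
  Part :: "'i \<Rightarrow> 'o set"
  Tau :: "'i \<Rightarrow> 'i"

definition below :: "('i, 'o) stability_data \<Rightarrow> 'i \<Rightarrow> 'i \<Rightarrow> bool" where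
  "below T a b \<longleftrightarrow> (a, b) \<in> Ord T \<and> a \<noteq> b"

definition order_automorphism :: "'i set \<Rightarrow> 'i rel \<Rightarrow> ('i \<Rightarrow> 'i) \<Rightarrow> bool" where
  "order_automorphism A r t \<longleftrightarrow> bij_betw t A A \<and>
     (\<forall>a \<in> A. \<forall>b \<in> A. (a, b) \<in> r \<longleftrightarrow> (t a, t b) \<in> r)"

definition has_filtration ::
  "('o, 'm, 'k) tricat \<Rightarrow> ('i, 'o) stability_data \<Rightarrow> 'o \<Rightarrow> bool" where
  "has_filtration C T x \<longleftrightarrow>
     (\<exists>(n :: nat) (Xs :: nat \<Rightarrow> 'o) (p :: nat \<Rightarrow> 'm) (A :: nat \<Rightarrow> 'o) (\<phi> :: nat \<Rightarrow> 'i).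
        Xs 0 = x \<and> zero_object C (Xs n) \<and>
        (\<forall>i \<in> {1..n}. p i \<in> Mor C (Xs i) (Xs (i - 1)) \<and> is_cone C (p i) (A i) \<and>
           \<not> zero_object C (A i) \<and> \<phi> i \<in> Idx T \<and> A i \<in> Part T (\<phi> i)) \<and>
        (\<forall>i \<in> {1..<n}. below T (\<phi> i) (\<phi> (i + 1))))"

definition t_stability ::
  "('o, 'm, 'k) tricat \<Rightarrow> ('i, 'o) stability_data \<Rightarrow> bool" where
  "t_stability C T \<longleftrightarrow>
     linear_order_on (Idx T) (Ord T) \<and>
     (\<forall>a \<in> Idx T. strictly_full C (Part T a) \<and> extension_closed C (Part T a) \<and>
        nonzero_subcategory C (Part T a)) \<and>
     order_automorphism (Idx T) (Ord T) (Tau T) \<and>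
     (\<forall>a \<in> Idx T. Part T (Tau T a) = shift_subcategory C (Part T a) \<and> (a, Tau T a) \<in> Ord T) \<and>
     (\<forall>a \<in> Idx T. \<forall>b \<in> Idx T. below T a b \<longrightarrow> nonpos_Mor_vanish C (Part T b) (Part T a)) \<and>
     (\<forall>x \<in> Obj C. \<not> zero_object C x \<longrightarrow> has_filtration C T x)"

definition finite_t_stability ::
  "('o, 'm, 'k) tricat \<Rightarrow> ('i, 'o) stability_data \<Rightarrow> bool" where
  "finite_t_stability C T \<longleftrightarrow> t_stability C T \<and> finite (Idx T)"

text \<open>\<open>finer C P T\<close>: the t-stability \<open>P\<close> is finer than \<open>T\<close>.\<close>

definition finer ::
  "('o, 'm, 'k) tricat \<Rightarrow> ('j, 'o) stability_data \<Rightarrow> ('i, 'o) stability_data \<Rightarrow> bool" where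
  "finer C P T \<longleftrightarrow>
     (\<exists>r. r ` Idx P = Idx T \<and>
        (\<forall>a \<in> Idx P. r (Tau P a) = Tau T (r a)) \<and>
        (\<forall>a \<in> Idx P. \<forall>b \<in> Idx P. below P a b \<longrightarrow> (r a, r b) \<in> Ord T) \<and>
        (\<forall>c \<in> Idx T. Part T c =
           generated_subcategory C (\<Union>a \<in> {a \<in> Idx P. r a = c}. Part P a)))"

end

(*
  Refining the filtration of an object by the filtrations of its factors is concatenation of
  filtrations: if x' -> x -> a is exact and a is filtered with factors s, x' with factors s',
  then the octahedral axiom filters x with factors s followed by s'. Because the shift is only
  essentially surjective, objects are tracked up to isomorphism and triangles through the
  relation "x, y, z fit into a distinguished triangle".

  On a finite chain an order automorphism that increases elements is the identity, so each part
  of a finite t-stability is a triangulated subcategory. It is closed under direct summands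
  because it equals the class of objects receiving no nonzero morphism from the higher parts and
  admitting none into the lower ones. Hence it contains the subcategory generated by its own
  refinement, and the filtrations give the converse inclusion.
*)
theory Submission
  imports Defs
begin

section \<open>Triangles and vanishing Hom sets as relations between objects\<close>

definition exact_triangle :: "('o, 'm, 'k) tricat \<Rightarrow> 'o \<Rightarrow> 'o \<Rightarrow> 'o \<Rightarrow> bool" where
  "exact_triangle C x y z \<longleftrightarrow>
     (\<exists>f \<in> Mor C x y. \<exists>g \<in> Mor C y z. \<exists>h \<in> Mor C z (ShO C x). (f, g, h) \<in> Tri C)"

definition Mor_vanish :: "('o, 'm, 'k) tricat \<Rightarrow> 'o \<Rightarrow> 'o \<Rightarrow> bool" where
  "Mor_vanish C x y \<longleftrightarrow> (\<forall>f \<in> Mor C x y. f = Zero C x y)"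

lemma Mor_Dom: "f \<in> Mor C x y \<Longrightarrow> Dom C f = x"
  and Mor_Cod: "f \<in> Mor C x y \<Longrightarrow> Cod C f = y"
  and Mor_Arr: "f \<in> Mor C x y \<Longrightarrow> f \<in> Arr C"
  by (auto simp: Mor_def)

lemma Mor_space_simps [simp]:
  "carrier (Mor_space C x y) = Mor C x y"
  "\<zero>\<^bsub>Mor_space C x y\<^esub> = Zero C x y"
  "f \<oplus>\<^bsub>Mor_space C x y\<^esub> g = Add C f g"
  by (simp_all add: Mor_space_def)

section \<open>Isomorphisms and zero objects\<close>

context category
begin

lemma Mor_Obj:
  assumes "f \<in> Mor C x y" shows "x \<in> Obj C" "y \<in> Obj C"
  using assms Dom_closed Cod_closed by (auto simp: Mor_def)

lemma isomorphic_iff: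
  "isomorphic C x y \<longleftrightarrow>
     (\<exists>f \<in> Mor C x y. \<exists>g \<in> Mor C y x. Comp C g f = Ident C x \<and> Comp C f g = Ident C y)"
  by (force simp: isomorphic_def isomorphism_def Mor_def)

lemma isomorphic_refl: "x \<in> Obj C \<Longrightarrow> isomorphic C x x"
  unfolding isomorphic_iff using Ident_closed Comp_Ident by blast

lemma isomorphic_sym: "isomorphic C x y \<Longrightarrow> isomorphic C y x"
  unfolding isomorphic_iff by blast

lemma isomorphic_Obj:
  assumes "isomorphic C x y" shows "x \<in> Obj C" "y \<in> Obj C"
  using assms Mor_Obj unfolding isomorphic_iff by blast+

lemma isomorphic_zero_object:
  assumes "isomorphic C x y" "zero_object C x" shows "zero_object C y"
proof -
  from assms(1) obtain f g where f: "f \<in> Mor C x y" and g: "g \<in> Mor C y x"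
    and fg: "Comp C f g = Ident C y" unfolding isomorphic_iff by blast
  show ?thesis unfolding zero_object_def
  proof (intro conjI ballI)
    show "y \<in> Obj C" using Mor_Obj f by blast
    fix w assume w: "w \<in> Obj C"
    obtain a b where a: "a \<in> Mor C w x" and b: "b \<in> Mor C x w"
      and ua: "\<And>a'. a' \<in> Mor C w x \<Longrightarrow> a' = a" and ub: "\<And>b'. b' \<in> Mor C x w \<Longrightarrow> b' = b"
      using assms(2) w unfolding zero_object_def by metis
    show "\<exists>!k. k \<in> Mor C w y"
    proof (rule ex1I)
      show "Comp C f a \<in> Mor C w y" using a f by (rule Comp_closed)
      fix k assume k: "k \<in> Mor C w y"
      have "k = Comp C (Comp C f g) k" using k by (simp add: fg Ident_Comp)
      also have "\<dots> = Comp C f (Comp C g k)" using Comp_assoc[OF k g f] by simp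
      finally show "k = Comp C f a" using ua[OF Comp_closed[OF k g]] by simp
    qed
    show "\<exists>!k. k \<in> Mor C y w"
    proof (rule ex1I)
      show "Comp C b g \<in> Mor C y w" using g b by (rule Comp_closed)
      fix k assume k: "k \<in> Mor C y w"
      have "k = Comp C k (Comp C f g)" using k by (simp add: fg Comp_Ident)
      also have "\<dots> = Comp C (Comp C k f) g" using Comp_assoc[OF g f k] by simp
      finally show "k = Comp C b g" using ub[OF Comp_closed[OF f k]] by simp
    qed
  qed
qed

lemma zero_objects_isomorphic:
  assumes "zero_object C x" "zero_object C y" shows "isomorphic C x y"
proof -
  have xy: "x \<in> Obj C" "y \<in> Obj C" using assms by (auto simp: zero_object_def)
  obtain f g where f: "f \<in> Mor C x y" and g: "g \<in> Mor C y x"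
    using assms(1) xy unfolding zero_object_def by metis
  have "Comp C g f = Ident C x" "Comp C f g = Ident C y"
    using assms xy Comp_closed[OF f g] Comp_closed[OF g f] Ident_closed
    unfolding zero_object_def by metis+
  then show ?thesis unfolding isomorphic_iff using f g by blast
qed

end

section \<open>Zero morphisms, signs and vanishing Hom sets\<close>

context linear_category
begin

lemma Mor_abelian_group: "x \<in> Obj C \<Longrightarrow> y \<in> Obj C \<Longrightarrow> abelian_group (Mor_space C x y)"
  using Mor_module module.axioms(2) by blast

lemma Zero_closed: "x \<in> Obj C \<Longrightarrow> y \<in> Obj C \<Longrightarrow> Zero C x y \<in> Mor C x y"
  using abelian_monoid.zero_closed[OF abelian_group.axioms(1)[OF Mor_abelian_group]] by simp

lemma neg_closed: "f \<in> Mor C x y \<Longrightarrow> \<ominus>\<^bsub>Mor_space C x y\<^esub> f \<in> Mor C x y"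
  using abelian_group.a_inv_closed[OF Mor_abelian_group] Mor_Obj by fastforce

lemma neg_neg: "f \<in> Mor C x y \<Longrightarrow> \<ominus>\<^bsub>Mor_space C x y\<^esub> (\<ominus>\<^bsub>Mor_space C x y\<^esub> f) = f"
  using abelian_group.minus_minus[OF Mor_abelian_group] Mor_Obj by fastforce

text \<open>Used to see that additive operations preserve zero: the image of a zero arrow equals its
  own double.\<close>

lemma Add_self_imp_Zero:
  assumes "f \<in> Mor C x y" "Add C f f = f" shows "f = Zero C x y"
proof -
  interpret abelian_group "Mor_space C x y" using assms Mor_Obj Mor_abelian_group by blast
  show ?thesis using assms add.l_cancel_one[of f f] by simp
qed

lemma Add_Zero_right: "f \<in> Mor C x y \<Longrightarrow> Add C f (Zero C x y) = f"
  using abelian_monoid.r_zero[OF abelian_group.axioms(1)[OF Mor_abelian_group]] Mor_Obj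
  by fastforce

lemma Comp_Zero_right:
  assumes "g \<in> Mor C y z" "x \<in> Obj C" shows "Comp C g (Zero C x y) = Zero C x z"
proof (rule Add_self_imp_Zero)
  have z: "Zero C x y \<in> Mor C x y" using assms Mor_Obj Zero_closed by blast
  show "Comp C g (Zero C x y) \<in> Mor C x z" using z assms Comp_closed by blast
  show "Add C (Comp C g (Zero C x y)) (Comp C g (Zero C x y)) = Comp C g (Zero C x y)"
    using Comp_Add_right[OF z z assms(1)] Add_Zero_right[OF z] by simp
qed

lemma Comp_Zero_left:
  assumes "f \<in> Mor C x y" "z \<in> Obj C" shows "Comp C (Zero C y z) f = Zero C x z"
proof (rule Add_self_imp_Zero)
  have z: "Zero C y z \<in> Mor C y z" using assms Mor_Obj Zero_closed by blast
  show "Comp C (Zero C y z) f \<in> Mor C x z" using z assms Comp_closed by blast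
  show "Add C (Comp C (Zero C y z) f) (Comp C (Zero C y z) f) = Comp C (Zero C y z) f"
    using Comp_Add_left[OF assms(1) z z] Add_Zero_right[OF z] by simp
qed

lemma neg_unique:
  assumes "f \<in> Mor C x y" "g \<in> Mor C x y" "Add C f g = Zero C x y"
  shows "f = \<ominus>\<^bsub>Mor_space C x y\<^esub> g"
proof -
  interpret abelian_group "Mor_space C x y" using assms Mor_Obj Mor_abelian_group by blast
  show ?thesis using assms minus_equality by simp
qed

lemma neg_Add: "f \<in> Mor C x y \<Longrightarrow> Add C (\<ominus>\<^bsub>Mor_space C x y\<^esub> f) f = Zero C x y"
  using abelian_group.l_neg[OF Mor_abelian_group] Mor_Obj by fastforce

lemma Comp_neg_right:
  assumes f: "f \<in> Mor C x y" and g: "g \<in> Mor C y z"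
  shows "Comp C g (\<ominus>\<^bsub>Mor_space C x y\<^esub> f) = \<ominus>\<^bsub>Mor_space C x z\<^esub> (Comp C g f)"
proof (rule neg_unique)
  show "Comp C g (\<ominus>\<^bsub>Mor_space C x y\<^esub> f) \<in> Mor C x z" "Comp C g f \<in> Mor C x z"
    using assms neg_closed Comp_closed by blast+
  show "Add C (Comp C g (\<ominus>\<^bsub>Mor_space C x y\<^esub> f)) (Comp C g f) = Zero C x z"
    using Comp_Add_right[OF neg_closed[OF f] f g] neg_Add[OF f] Comp_Zero_right[OF g] Mor_Obj[OF f]
    by simp
qed

lemma Comp_neg_left:
  assumes f: "f \<in> Mor C x y" and g: "g \<in> Mor C y z"
  shows "Comp C (\<ominus>\<^bsub>Mor_space C y z\<^esub> g) f = \<ominus>\<^bsub>Mor_space C x z\<^esub> (Comp C g f)"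
proof (rule neg_unique)
  show "Comp C (\<ominus>\<^bsub>Mor_space C y z\<^esub> g) f \<in> Mor C x z" "Comp C g f \<in> Mor C x z"
    using assms neg_closed Comp_closed by blast+
  show "Add C (Comp C (\<ominus>\<^bsub>Mor_space C y z\<^esub> g) f) (Comp C g f) = Zero C x z"
    using Comp_Add_left[OF f neg_closed[OF g] g] neg_Add[OF g] Comp_Zero_left[OF f] Mor_Obj[OF g]
    by simp
qed

text \<open>Every arrow into or out of \<open>z\<close> factors through the identity of
  \<open>z\<close>, so a vanishing identity leaves only zero arrows.\<close>

lemma zero_object_iff: "zero_object C z \<longleftrightarrow> z \<in> Obj C \<and> Ident C z = Zero C z z"
proof
  assume "zero_object C z"
  then show "z \<in> Obj C \<and> Ident C z = Zero C z z"
    unfolding zero_object_def using Ident_closed Zero_closed by metis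
next
  assume z: "z \<in> Obj C \<and> Ident C z = Zero C z z"
  have 1: "f = Zero C x z" if "f \<in> Mor C x z" for f x
    using Ident_Comp[OF that] Comp_Zero_left[OF that] z by simp
  have 2: "f = Zero C z x" if "f \<in> Mor C z x" for f x
    using Comp_Ident[OF that] Comp_Zero_right[OF that] z by simp
  show "zero_object C z" unfolding zero_object_def
    using z 1 2 Zero_closed by metis
qed

text \<open>Allows objects to be recognised as zero from Hom computations alone.\<close>

lemma zero_object_iff_Mor_vanish: "zero_object C z \<longleftrightarrow> z \<in> Obj C \<and> Mor_vanish C z z"
proof
  assume z: "zero_object C z"
  then have "z \<in> Obj C" by (simp add: zero_object_iff)
  then show "z \<in> Obj C \<and> Mor_vanish C z z"
    using z Zero_closed unfolding zero_object_def Mor_vanish_def by blast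
qed (auto simp: zero_object_iff Mor_vanish_def dest: Ident_closed)

lemma Mor_vanish_zero_left: "zero_object C z \<Longrightarrow> x \<in> Obj C \<Longrightarrow> Mor_vanish C z x"
  and Mor_vanish_zero_right: "zero_object C z \<Longrightarrow> x \<in> Obj C \<Longrightarrow> Mor_vanish C x z"
  using Zero_closed unfolding zero_object_def Mor_vanish_def by metis+

lemma Mor_vanish_isomorphic_right:
  assumes "Mor_vanish C x y" "isomorphic C y y'" shows "Mor_vanish C x y'"
  unfolding Mor_vanish_def
proof
  fix k assume k: "k \<in> Mor C x y'"
  from assms(2) obtain f g where f: "f \<in> Mor C y y'" and g: "g \<in> Mor C y' y"
    and fg: "Comp C f g = Ident C y'" unfolding isomorphic_iff by blast
  have "k = Comp C f (Comp C g k)" using Comp_assoc[OF k g f] k by (simp add: fg Ident_Comp)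
  also have "\<dots> = Comp C f (Zero C x y)"
    using assms(1) Comp_closed[OF k g] unfolding Mor_vanish_def by simp
  finally show "k = Zero C x y'" using Comp_Zero_right[OF f] Mor_Obj[OF k] by simp
qed

text \<open>An arrow into or out of the summand \<open>x\<close> factors through \<open>z\<close>,
  because the inclusion of \<open>x\<close> followed by the projection is the identity.\<close>

lemma Mor_vanish_summand:
  assumes b: "biproduct C x y z"
  shows "Mor_vanish C w z \<Longrightarrow> Mor_vanish C w x" "Mor_vanish C z w \<Longrightarrow> Mor_vanish C x w"
proof -
  obtain i p where i: "i \<in> Mor C x z" and p: "p \<in> Mor C z x" and pi: "Comp C p i = Ident C x"
    using b unfolding biproduct_def by blast
  show "Mor_vanish C w x" if v: "Mor_vanish C w z"
    unfolding Mor_vanish_def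
  proof
    fix f assume f: "f \<in> Mor C w x"
    have "f = Comp C p (Comp C i f)" using Comp_assoc[OF f i p] f by (simp add: pi Ident_Comp)
    also have "Comp C i f = Zero C w z" using v Comp_closed[OF f i] by (simp add: Mor_vanish_def)
    finally show "f = Zero C w x" using Comp_Zero_right[OF p] Mor_Obj[OF f] by simp
  qed
  show "Mor_vanish C x w" if v: "Mor_vanish C z w"
    unfolding Mor_vanish_def
  proof
    fix f assume f: "f \<in> Mor C x w"
    have "f = Comp C (Comp C f p) i" using Comp_assoc[OF i p f] f by (simp add: pi Comp_Ident)
    also have "Comp C f p = Zero C z w" using v Comp_closed[OF p f] by (simp add: Mor_vanish_def)
    finally show "f = Zero C x w" using Comp_Zero_left[OF i] Mor_Obj[OF f] by simp
  qed
qed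

end

section \<open>The shift and distinguished triangles\<close>

context triangulated_category
begin

lemma ShA_closed: "f \<in> Mor C x y \<Longrightarrow> ShA C f \<in> Mor C (ShO C x) (ShO C y)"
  using ShA_bij Mor_Obj bij_betwE by metis

lemma ShA_full:
  assumes "k \<in> Mor C (ShO C x) (ShO C y)" "x \<in> Obj C" "y \<in> Obj C"
  obtains f where "f \<in> Mor C x y" "ShA C f = k"
  using assms ShA_bij bij_betw_imp_surj_on by (metis imageE)

lemma ShA_faithful: "f \<in> Mor C x y \<Longrightarrow> g \<in> Mor C x y \<Longrightarrow> ShA C f = ShA C g \<Longrightarrow> f = g"
  using ShA_bij[of x y] Mor_Obj by (metis bij_betw_def inj_onD)

lemma ShA_Zero:
  assumes "x \<in> Obj C" "y \<in> Obj C" shows "ShA C (Zero C x y) = Zero C (ShO C x) (ShO C y)"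
proof (rule Add_self_imp_Zero)
  have z: "Zero C x y \<in> Mor C x y" using assms Zero_closed by blast
  show "ShA C (Zero C x y) \<in> Mor C (ShO C x) (ShO C y)" using z by (rule ShA_closed)
  show "Add C (ShA C (Zero C x y)) (ShA C (Zero C x y)) = ShA C (Zero C x y)"
    using ShA_Add[OF z z] Add_Zero_right[OF z] by simp
qed

lemma zero_object_ShO: "zero_object C z \<Longrightarrow> zero_object C (ShO C z)"
  unfolding zero_object_iff using ShO_closed ShA_Ident ShA_Zero by metis

text \<open>A fully faithful functor reflects isomorphisms: both inverse arrows lift through the
  shift, and faithfulness turns the two composites into identities.\<close>

lemma isomorphic_ShO_cancel:
  assumes iso: "isomorphic C (ShO C x) (ShO C y)" and x: "x \<in> Obj C" and y: "y \<in> Obj C"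
  shows "isomorphic C x y"
proof -
  from iso obtain f' g' where f': "f' \<in> Mor C (ShO C x) (ShO C y)"
    and g': "g' \<in> Mor C (ShO C y) (ShO C x)"
    and eq: "Comp C g' f' = Ident C (ShO C x)" "Comp C f' g' = Ident C (ShO C y)"
    unfolding isomorphic_iff by blast
  obtain f where f: "f \<in> Mor C x y" "ShA C f = f'" using ShA_full f' x y by metis
  obtain g where g: "g \<in> Mor C y x" "ShA C g = g'" using ShA_full g' x y by metis
  have "Comp C g f = Ident C x"
    using ShA_faithful Comp_closed[OF f(1) g(1)] Ident_closed[OF x] ShA_Comp[OF f(1) g(1)]
      ShA_Ident[OF x] eq(1) f(2) g(2) by metis
  moreover have "Comp C f g = Ident C y"
    using ShA_faithful Comp_closed[OF g(1) f(1)] Ident_closed[OF y] ShA_Comp[OF g(1) f(1)]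
      ShA_Ident[OF y] eq(2) f(2) g(2) by metis
  ultimately show ?thesis unfolding isomorphic_iff using f g by blast
qed

lemma Mor_vanish_ShO_iff:
  assumes x: "x \<in> Obj C" and y: "y \<in> Obj C"
  shows "Mor_vanish C (ShO C x) (ShO C y) \<longleftrightarrow> Mor_vanish C x y"
proof
  assume v: "Mor_vanish C (ShO C x) (ShO C y)"
  show "Mor_vanish C x y" unfolding Mor_vanish_def
  proof
    fix f assume f: "f \<in> Mor C x y"
    have "ShA C f = ShA C (Zero C x y)"
      using v ShA_closed[OF f] ShA_Zero[OF x y] by (simp add: Mor_vanish_def)
    then show "f = Zero C x y" using ShA_faithful f Zero_closed x y by blast
  qed
next
  assume v: "Mor_vanish C x y"
  show "Mor_vanish C (ShO C x) (ShO C y)" unfolding Mor_vanish_def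
    using v ShA_full x y ShA_Zero unfolding Mor_vanish_def by metis
qed

lemma Tri_Mor:
  assumes "(f, g, h) \<in> Tri C"
  shows "f \<in> Mor C (Dom C f) (Cod C f)" "g \<in> Mor C (Cod C f) (Cod C g)"
    "h \<in> Mor C (Cod C g) (ShO C (Dom C f))"
  using Tri_shape[OF assms] by (auto simp: triangle_shape_def Mor_def)

lemma exact_triangleI: "(f, g, h) \<in> Tri C \<Longrightarrow> exact_triangle C (Dom C f) (Cod C f) (Cod C g)"
  unfolding exact_triangle_def using Tri_Mor by blast

lemma exact_triangle_Obj:
  assumes "exact_triangle C x y z" shows "x \<in> Obj C" "y \<in> Obj C" "z \<in> Obj C"
  using assms Mor_Obj unfolding exact_triangle_def by blast+

lemma is_cone_exact_triangle:
  assumes "is_cone C f z" "f \<in> Mor C x y" shows "exact_triangle C x y z"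
  using assms exact_triangleI unfolding is_cone_def by (auto simp: Mor_def)

lemma Tri_rotate_left:
  assumes "(f, g, h) \<in> Tri C" "f \<in> Mor C x y"
  shows "(g, h, \<ominus>\<^bsub>Mor_space C (ShO C x) (ShO C y)\<^esub> ShA C f) \<in> Tri C"
  using Tri_rotate[OF Tri_shape[OF assms(1)]] assms by (auto simp: Mor_def)

lemma exact_triangle_rotate:
  assumes "exact_triangle C x y z" shows "exact_triangle C y z (ShO C x)"
  using assms Tri_rotate_left exact_triangleI unfolding exact_triangle_def
  by (metis (no_types, lifting) ShA_closed neg_closed)

lemma exact_triangle_unrotate:
  assumes t: "exact_triangle C y z (ShO C x)" and x: "x \<in> Obj C"
  shows "exact_triangle C x y z"
proof -
  obtain g h k where ghk: "(g, h, k) \<in> Tri C" and g: "g \<in> Mor C y z"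
    and h: "h \<in> Mor C z (ShO C x)" and k: "k \<in> Mor C (ShO C x) (ShO C y)"
    using t unfolding exact_triangle_def by blast
  \<comment> \<open>The rotation axiom has the negative of the shifted first arrow in third place,
    so \<open>f\<close> must lift the negative of \<open>k\<close>.\<close>
  obtain f where f: "f \<in> Mor C x y"
    and fk: "ShA C f = \<ominus>\<^bsub>Mor_space C (ShO C x) (ShO C y)\<^esub> k"
    using ShA_full[OF neg_closed[OF k] x] Mor_Obj[OF g] by blast
  have "triangle_shape C f g h" using f g h by (auto simp: triangle_shape_def Mor_def)
  from Tri_rotate[OF this] have "(f, g, h) \<in> Tri C"
    using ghk f fk k by (simp add: Mor_Dom Mor_Cod neg_neg)
  then show ?thesis unfolding exact_triangle_def using f g h by blast
qed

text \<open>Conjugating the arrows by the chosen isomorphisms produces an isomorphism of triangles,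
  and distinguished triangles are closed under these. This lets an object be replaced by a shift
  that is merely isomorphic to it.\<close>

lemma exact_triangle_isomorphic:
  assumes t: "exact_triangle C x y z"
    and "isomorphic C x x'" "isomorphic C y y'" "isomorphic C z z'"
  shows "exact_triangle C x' y' z'"
proof -
  obtain f g h where f: "f \<in> Mor C x y" and g: "g \<in> Mor C y z"
    and h: "h \<in> Mor C z (ShO C x)" and fgh: "(f, g, h) \<in> Tri C"
    using t unfolding exact_triangle_def by blast
  obtain u u' where u: "u \<in> Mor C x x'" "u' \<in> Mor C x' x"
    "Comp C u' u = Ident C x" "Comp C u u' = Ident C x'"
    using assms unfolding isomorphic_iff by blast
  obtain v v' where v: "v \<in> Mor C y y'" "v' \<in> Mor C y' y"
    "Comp C v' v = Ident C y" "Comp C v v' = Ident C y'"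
    using assms unfolding isomorphic_iff by blast
  obtain w w' where w: "w \<in> Mor C z z'" "w' \<in> Mor C z' z"
    "Comp C w' w = Ident C z" "Comp C w w' = Ident C z'"
    using assms unfolding isomorphic_iff by blast
  define f' where "f' = Comp C (Comp C v f) u'"
  define g' where "g' = Comp C (Comp C w g) v'"
  define h' where "h' = Comp C (Comp C (ShA C u) h) w'"
  have vf: "Comp C v f \<in> Mor C x y'" and wg: "Comp C w g \<in> Mor C y z'"
    and uh: "Comp C (ShA C u) h \<in> Mor C z (ShO C x')"
    using f g h u v w Comp_closed ShA_closed by blast+
  have f': "f' \<in> Mor C x' y'" and g': "g' \<in> Mor C y' z'" and h': "h' \<in> Mor C z' (ShO C x')"
    unfolding f'_def g'_def h'_def using u v w vf wg uh Comp_closed by blast+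
  have "Comp C f' u = Comp C v f" "Comp C g' v = Comp C w g" "Comp C h' w = Comp C (ShA C u) h"
    unfolding f'_def g'_def h'_def
    using Comp_assoc[OF u(1,2) vf] Comp_assoc[OF v(1,2) wg] Comp_assoc[OF w(1,2) uh]
      Comp_Ident vf wg uh by (simp_all add: u v w)
  then have m: "triangle_morphism C (f, g, h) (f', g', h') u v w"
    unfolding triangle_morphism_def using f g h f' g' h' u v w
    by (simp add: Mor_Dom)
  have iso: "isomorphism C u" "isomorphism C v" "isomorphism C w"
    unfolding isomorphism_def using u v w by (auto simp: Mor_Dom Mor_Cod Mor_Arr)
  have "triangle_shape C f' g' h'" using f' g' h' by (auto simp: triangle_shape_def Mor_def)
  from Tri_iso_closed[OF fgh this m iso] show ?thesis
    unfolding exact_triangle_def using f' g' h' by blast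
qed

text \<open>Obtained by rotating backwards the triangle on the identity of \<open>x\<close> whose
  third vertex is the zero object \<open>ShO C z\<close>.\<close>

lemma zero_object_triangle:
  assumes x: "x \<in> Obj C" and z: "zero_object C z"
  shows "(Zero C z x, Ident C x, Zero C x (ShO C z)) \<in> Tri C"
proof -
  have zO: "z \<in> Obj C" using z by (simp add: zero_object_iff)
  have zs: "zero_object C (ShO C z)" using z by (rule zero_object_ShO)
  have f: "Zero C z x \<in> Mor C z x" using Zero_closed zO x by blast
  have 0: "Zero C x (ShO C z) \<in> Mor C x (ShO C z)" using Zero_closed ShO_closed zO x by blast
  have neg: "\<ominus>\<^bsub>Mor_space C (ShO C z) (ShO C x)\<^esub> ShA C (Zero C z x) = Zero C (ShO C z) (ShO C x)"
    using neg_closed[OF ShA_closed[OF f]] Mor_vanish_zero_left[OF zs ShO_closed[OF x]]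
    by (simp add: Mor_vanish_def)
  have "triangle_shape C (Zero C z x) (Ident C x) (Zero C x (ShO C z))"
    using f 0 Ident_closed[OF x] by (auto simp: triangle_shape_def Mor_def)
  from Tri_rotate[OF this] show ?thesis
    using Tri_Ident[OF x zs] f neg by (simp add: Mor_Dom Mor_Cod)
qed

text \<open>The vanishing of \<open>Comp C k f\<close> gives a commutative square towards the
  triangle with vertices \<open>0\<close>, \<open>w\<close>, \<open>w\<close>, and the filling axiom
  supplies \<open>l\<close>.\<close>

lemma Tri_factor_cone:
  assumes t: "(f, g, h) \<in> Tri C" and f: "f \<in> Mor C x y" and g: "g \<in> Mor C y z"
    and k: "k \<in> Mor C y w" and kf: "Comp C k f = Zero C x w"
  obtains l where "l \<in> Mor C z w" "Comp C l g = k"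
proof -
  obtain o' where o': "zero_object C o'" using zero_object_exists by blast
  have O: "o' \<in> Obj C" using o' by (simp add: zero_object_iff)
  have xO: "x \<in> Obj C" and wO: "w \<in> Obj C" using f k Mor_Obj by blast+
  have z1: "Zero C x o' \<in> Mor C x o'" and z2: "Zero C o' w \<in> Mor C o' w"
    and z3: "Zero C w (ShO C o') \<in> Mor C w (ShO C o')"
    using Zero_closed xO O wO ShO_closed by blast+
  have hM: "h \<in> Mor C z (ShO C x)" using Tri_Mor(3)[OF t] f g by (simp add: Mor_Dom Mor_Cod)
  have "Comp C k f = Comp C (Zero C o' w) (Zero C x o')"
    using kf Comp_Zero_left[OF z1 wO] by simp
  then obtain l where "triangle_morphism C (f, g, h)
      (Zero C o' w, Ident C w, Zero C w (ShO C o')) (Zero C x o') k l"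
    using Tri_fill[OF t zero_object_triangle[OF wO o'], of "Zero C x o'" k] f k z1 z2
    by (auto simp: Mor_Dom Mor_Cod)
  then have "l \<in> Mor C z w" "Comp C l g = Comp C (Ident C w) k"
    using hM z3 by (auto simp: triangle_morphism_def Mor_Dom)
  then show ?thesis using that Ident_Comp[OF k] by simp
qed

text \<open>Dual to \<open>Tri_factor_cone\<close>. Only a third arrow can be filled in, so both
  triangles are rotated first; the filler is an arrow between shifts, brought back by
  fullness.\<close>

lemma Tri_factor_fibre:
  assumes t: "(f, g, h) \<in> Tri C" and f: "f \<in> Mor C x y" and g: "g \<in> Mor C y z"
    and k: "k \<in> Mor C w y" and gk: "Comp C g k = Zero C w z"
  obtains l where "l \<in> Mor C w x" "Comp C f l = k"
proof -
  obtain o' where o': "zero_object C o'" using zero_object_exists by blast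
  have O: "o' \<in> Obj C" using o' by (simp add: zero_object_iff)
  have xO: "x \<in> Obj C" and yO: "y \<in> Obj C" and zO: "z \<in> Obj C" and wO: "w \<in> Obj C"
    using f g k Mor_Obj by blast+
  let ?n = "\<lambda>a b. a_inv (Mor_space C (ShO C a) (ShO C b))"
  have z1: "Zero C w o' \<in> Mor C w o'" and z2: "Zero C o' z \<in> Mor C o' z"
    using Zero_closed O wO zO by blast+
  have id: "Ident C w \<in> Mor C w w" "Ident C (ShO C w) \<in> Mor C (ShO C w) (ShO C w)"
    using Ident_closed wO ShO_closed by blast+
  have h: "h \<in> Mor C z (ShO C x)" using Tri_Mor(3)[OF t] f g by (simp add: Mor_Dom Mor_Cod)
  have t1: "(g, h, ?n x y (ShA C f)) \<in> Tri C" using Tri_rotate_left[OF t f] .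
  have t2: "(Zero C w o', Zero C o' (ShO C w), ?n w w (Ident C (ShO C w))) \<in> Tri C"
    using Tri_rotate_left[OF Tri_Ident[OF wO o'] id(1)] by (simp add: ShA_Ident wO)
  have "Comp C (Zero C o' z) (Zero C w o') = Comp C g k"
    using gk Comp_Zero_left[OF z1 zO] by simp
  then obtain m where "triangle_morphism C
      (Zero C w o', Zero C o' (ShO C w), ?n w w (Ident C (ShO C w)))
      (g, h, ?n x y (ShA C f)) k (Zero C o' z) m"
    using Tri_fill[OF t2 t1, of k "Zero C o' z"] g k z1 z2 by (auto simp: Mor_Dom Mor_Cod)
  then have m: "m \<in> Mor C (ShO C w) (ShO C x)"
    and eq: "Comp C (ShA C k) (?n w w (Ident C (ShO C w))) = Comp C (?n x y (ShA C f)) m"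
    using neg_closed[OF id(2)] neg_closed[OF ShA_closed[OF f]]
    by (auto simp: triangle_morphism_def Mor_Dom)
  obtain l where l: "l \<in> Mor C w x" and lm: "ShA C l = m" using ShA_full[OF m wO xO] by blast
  \<comment> \<open>Each of the two rotations introduced a sign, and the signs cancel.\<close>
  have "?n w y (ShA C k) = ?n w y (Comp C (ShA C f) m)"
    using eq Comp_neg_right[OF id(2) ShA_closed[OF k]] Comp_neg_left[OF m ShA_closed[OF f]]
      Comp_Ident[OF ShA_closed[OF k]] by simp
  then have "ShA C k = Comp C (ShA C f) m"
    using neg_neg[OF ShA_closed[OF k]] neg_neg[OF Comp_closed[OF m ShA_closed[OF f]]] by metis
  also have "\<dots> = ShA C (Comp C f l)" using ShA_Comp[OF l f] lm by simp
  finally have "Comp C f l = k" using ShA_faithful[OF k Comp_closed[OF l f]] by simp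
  then show ?thesis using that l by blast
qed

text \<open>Exactness of \<open>Hom(-, w)\<close> at the middle vertex: an arrow that dies on
  \<open>x\<close> factors through \<open>z\<close>.\<close>

lemma Mor_vanish_triangle_left:
  assumes "exact_triangle C x y z" "Mor_vanish C x w" "Mor_vanish C z w"
  shows "Mor_vanish C y w"
  unfolding Mor_vanish_def
proof
  fix k assume k: "k \<in> Mor C y w"
  obtain f g h where t: "(f, g, h) \<in> Tri C" and f: "f \<in> Mor C x y" and g: "g \<in> Mor C y z"
    using assms unfolding exact_triangle_def by blast
  have "Comp C k f = Zero C x w" using assms(2) Comp_closed[OF f k] by (simp add: Mor_vanish_def)
  then obtain l where "l \<in> Mor C z w" "Comp C l g = k" using Tri_factor_cone[OF t f g k] by blast
  then show "k = Zero C y w"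
    using assms(3) Comp_Zero_left[OF g] Mor_Obj[OF k] unfolding Mor_vanish_def by auto
qed

text \<open>Exactness of \<open>Hom(w, -)\<close> at the middle vertex: an arrow that dies in
  \<open>z\<close> factors through \<open>x\<close>.\<close>

lemma Mor_vanish_triangle_right:
  assumes "exact_triangle C x y z" "Mor_vanish C w x" "Mor_vanish C w z"
  shows "Mor_vanish C w y"
  unfolding Mor_vanish_def
proof
  fix k assume k: "k \<in> Mor C w y"
  obtain f g h where t: "(f, g, h) \<in> Tri C" and f: "f \<in> Mor C x y" and g: "g \<in> Mor C y z"
    using assms unfolding exact_triangle_def by blast
  have "Comp C g k = Zero C w z" using assms(3) Comp_closed[OF k g] by (simp add: Mor_vanish_def)
  then obtain l where "l \<in> Mor C w x" "Comp C f l = k" using Tri_factor_fibre[OF t f g k] by blast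
  then show "k = Zero C w y"
    using assms(2) Comp_Zero_right[OF f] Mor_Obj[OF k] unfolding Mor_vanish_def by auto
qed

text \<open>The identity of \<open>y\<close> lifts along the first arrow, giving a right inverse. In
  the rotated triangle the identity of \<open>ShO C x\<close> factors through the shifted first
  arrow up to sign, giving a left inverse. The two one-sided inverses agree.\<close>

lemma exact_triangle_zero_isomorphic:
  assumes "exact_triangle C x y z" and z: "zero_object C z"
  shows "isomorphic C x y"
proof -
  obtain f g h where t: "(f, g, h) \<in> Tri C" and f: "f \<in> Mor C x y" and g: "g \<in> Mor C y z"
    and h: "h \<in> Mor C z (ShO C x)"
    using assms unfolding exact_triangle_def by blast
  have xO: "x \<in> Obj C" and yO: "y \<in> Obj C" using f Mor_Obj by blast+
  note sO = ShO_closed[OF xO] ShO_closed[OF yO]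
  let ?n = "a_inv (Mor_space C (ShO C x) (ShO C y))"
  have "Comp C g (Ident C y) = Zero C y z"
    using Mor_vanish_zero_right[OF z yO] g Comp_Ident[OF g] by (simp add: Mor_vanish_def)
  then obtain r where r: "r \<in> Mor C y x" and fr: "Comp C f r = Ident C y"
    using Tri_factor_fibre[OF t f g Ident_closed[OF yO]] by blast
  have nf: "?n (ShA C f) \<in> Mor C (ShO C x) (ShO C y)" using neg_closed[OF ShA_closed[OF f]] .
  have t2: "(h, ?n (ShA C f), \<ominus>\<^bsub>Mor_space C (ShO C y) (ShO C z)\<^esub> ShA C g) \<in> Tri C"
    using Tri_rotate_left[OF Tri_rotate_left[OF t f] g] .
  have "Comp C (Ident C (ShO C x)) h = Zero C z (ShO C x)"
    using Mor_vanish_zero_left[OF z sO(1)] h Ident_Comp[OF h] by (simp add: Mor_vanish_def)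
  then obtain m where m: "m \<in> Mor C (ShO C y) (ShO C x)"
    and mf: "Comp C m (?n (ShA C f)) = Ident C (ShO C x)"
    using Tri_factor_cone[OF t2 h nf Ident_closed[OF sO(1)]] by blast
  obtain l where l: "l \<in> Mor C y x" and lm: "ShA C l = \<ominus>\<^bsub>Mor_space C (ShO C y) (ShO C x)\<^esub> m"
    using ShA_full[OF neg_closed[OF m] yO xO] by blast
  have "ShA C (Comp C l f) = Ident C (ShO C x)"
    using ShA_Comp[OF f l] lm mf Comp_neg_left[OF ShA_closed[OF f] m]
      Comp_neg_right[OF ShA_closed[OF f] m] by simp
  then have lf: "Comp C l f = Ident C x"
    using ShA_faithful[OF Comp_closed[OF f l] Ident_closed[OF xO]] ShA_Ident[OF xO] by simp
  have "r = Comp C (Comp C l f) r" using lf Ident_Comp[OF r] by simp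
  also have "\<dots> = l" using Comp_assoc[OF r f l] fr Comp_Ident[OF l] by simp
  finally show ?thesis unfolding isomorphic_iff using f l lf fr by blast
qed

text \<open>The object \<open>y\<close> is the fibre of the composite from \<open>x\<close> through
  \<open>a\<close> to \<open>c\<close>; the octahedral axiom relates it to the fibres
  \<open>x'\<close> and \<open>b\<close> of the two factors.\<close>

lemma exact_triangle_refine:
  assumes "exact_triangle C x' x a" "exact_triangle C b a c"
  obtains y where "exact_triangle C y x c" "exact_triangle C x' y b"
proof -
  obtain f g h where t: "(f, g, h) \<in> Tri C" and f: "f \<in> Mor C x' x" and g: "g \<in> Mor C x a"
    and h: "h \<in> Mor C a (ShO C x')"
    using assms(1) unfolding exact_triangle_def by blast
  obtain p q r where t': "(p, q, r) \<in> Tri C" and p: "p \<in> Mor C b a" and q: "q \<in> Mor C a c"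
    and r: "r \<in> Mor C c (ShO C b)"
    using assms(2) unfolding exact_triangle_def by blast
  have qg: "Comp C q g \<in> Mor C x c" using Comp_closed[OF g q] .
  then obtain s s' where t'': "(Comp C q g, s, s') \<in> Tri C"
    using Tri_complete Mor_Arr by metis
  let ?e = "Cod C s"
  have te: "exact_triangle C x c ?e" using exact_triangleI[OF t''] qg by (simp add: Mor_Dom Mor_Cod)
  \<comment> \<open>The cones of the two factors are the shifts of \<open>x'\<close> and
    \<open>b\<close>, so the octahedron yields the wanted second triangle, shifted once.\<close>
  obtain u v where "(u, v, Comp C (ShA C h) (\<ominus>\<^bsub>Mor_space C (ShO C b) (ShO C a)\<^esub> ShA C p)) \<in> Tri C"
    and u: "u \<in> Mor C (Cod C h) ?e" and v: "v \<in> Mor C ?e (Cod C r)"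
    using Tri_octahedral[OF g q Tri_rotate_left[OF t f] t'' Tri_rotate_left[OF t' p]] by blast
  then have tu: "exact_triangle C (ShO C x') ?e (ShO C b)"
    using exact_triangleI[of u v] h r by (simp add: Mor_Dom Mor_Cod)
  \<comment> \<open>The cone of the composite is a shift only up to isomorphism.\<close>
  obtain y where y: "y \<in> Obj C" and ye: "isomorphic C (ShO C y) ?e"
    using ShO_ess_surj exact_triangle_Obj(3)[OF te] by blast
  note O = exact_triangle_Obj[OF assms(1)] exact_triangle_Obj[OF assms(2)]
  have "exact_triangle C x c (ShO C y)"
    using exact_triangle_isomorphic[OF te] isomorphic_refl isomorphic_sym[OF ye] O by blast
  then have 1: "exact_triangle C y x c" using exact_triangle_unrotate y by blast
  have "exact_triangle C (ShO C x') (ShO C y) (ShO C b)"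
    using exact_triangle_isomorphic[OF tu] isomorphic_refl isomorphic_sym[OF ye] O ShO_closed
    by blast
  \<comment> \<open>Rotating back three times removes the shift from all three vertices.\<close>
  then have "exact_triangle C x' y b" using exact_triangle_unrotate y O by blast
  with 1 show ?thesis using that by blast
qed

end

section \<open>Filtrations as lists of indices\<close>

text \<open>The list starts with the index of the cone of the arrow into \<open>x\<close> and
  continues with the filtration of its source. No order is imposed, so that filtrations can be
  concatenated before sortedness is considered, and zero objects carry the empty list.\<close>

inductive filtered ::
  "('o, 'm, 'k) tricat \<Rightarrow> ('i \<Rightarrow> 'o set) \<Rightarrow> 'i list \<Rightarrow> 'o \<Rightarrow> bool"
  for C S where
  zero: "zero_object C x \<Longrightarrow> filtered C S [] x"
| step: "p \<in> Mor C y x \<Longrightarrow> is_cone C p A \<Longrightarrow> \<not> zero_object C A \<Longrightarrow> A \<in> S a \<Longrightarrow>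
    filtered C S s y \<Longrightarrow> filtered C S (a # s) x"

lemma transp_below: "linear_order_on (Idx T) (Ord T) \<Longrightarrow> transp (below T)"
  unfolding transp_def below_def order_on_defs by (metis antisymD transD)

lemma has_filtrationD:
  assumes "linear_order_on (Idx T) (Ord T)" "has_filtration C T x"
  obtains s where "filtered C (Part T) s x" "set s \<subseteq> Idx T" "sorted_wrt (below T) s"
proof -
  from assms(2) show ?thesis unfolding has_filtration_def
  proof (elim exE conjE)
    fix n :: nat and Xs p A \<phi>
    assume 0: "Xs 0 = x" and n: "zero_object C (Xs n)"
      and cones: "\<forall>i \<in> {1..n}. p i \<in> Mor C (Xs i) (Xs (i - 1)) \<and> is_cone C (p i) (A i) \<and>
             \<not> zero_object C (A i) \<and> \<phi> i \<in> Idx T \<and> A i \<in> Part T (\<phi> i)"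
      and lt: "\<forall>i \<in> {1..<n}. below T (\<phi> i) (\<phi> (i + 1))"
    \<comment> \<open>Every tail of the sequence is a filtration of its own first object; the
      induction runs down from the zero object \<open>Xs n\<close>.\<close>
    have f: "filtered C (Part T) (map \<phi> [Suc j..<Suc n]) (Xs j)" if "j \<le> n" for j
      using that
    proof (induction rule: inc_induct)
      case base
      then show ?case using n by (simp add: filtered.zero)
    next
      case (step j)
      have "[Suc j..<Suc n] = Suc j # [Suc (Suc j)..<Suc n]"
        using step.hyps by (simp add: upt_conv_Cons)
      moreover have "filtered C (Part T) (\<phi> (Suc j) # map \<phi> [Suc (Suc j)..<Suc n]) (Xs j)"
        using step.IH step.hyps bspec[OF cones, of "Suc j"]
        by (intro filtered.step[of "p (Suc j)" _ "Xs (Suc j)" _ "A (Suc j)"]) auto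
      ultimately show ?case by simp
    qed
    show ?thesis
    proof (rule that)
      show "filtered C (Part T) (map \<phi> [1..<Suc n]) x" using f[of 0] 0 by simp
      show "set (map \<phi> [1..<Suc n]) \<subseteq> Idx T" using cones by auto
      show "sorted_wrt (below T) (map \<phi> [1..<Suc n])"
        using lt by (auto simp: sorted_wrt_iff_nth_Suc_transp[OF transp_below[OF assms(1)]]
            nth_append simp del: upt_Suc)
    qed
  qed
qed

lemma has_filtrationI:
  assumes "filtered C (Part T) s x" "set s \<subseteq> Idx T" "sorted_wrt (below T) s"
  shows "has_filtration C T x"
proof -
  have "\<exists>Xs p A. Xs 0 = x \<and> zero_object C (Xs (length s)) \<and>
      (\<forall>i < length s. p (Suc i) \<in> Mor C (Xs (Suc i)) (Xs i) \<and> is_cone C (p (Suc i)) (A (Suc i)) \<and>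
           \<not> zero_object C (A (Suc i)) \<and> A (Suc i) \<in> Part T (s ! i))"
    using assms(1)
  proof (induction rule: filtered.induct)
    case (zero x)
    then show ?case by auto
  next
    case (step q y x B a s)
    then obtain Xs p A where IH: "Xs 0 = y" "zero_object C (Xs (length s))"
      "\<And>i. i < length s \<Longrightarrow> p (Suc i) \<in> Mor C (Xs (Suc i)) (Xs i) \<and>
         is_cone C (p (Suc i)) (A (Suc i)) \<and>
         \<not> zero_object C (A (Suc i)) \<and> A (Suc i) \<in> Part T (s ! i)"
      by blast
    \<comment> \<open>A new object is put in front, so all old positions move up by one; arrows and
      cones are numbered from 1, hence the new ones go to place 1.\<close>
    let ?X = "case_nat x Xs"
      and ?p = "\<lambda>i. if i = 1 then q else p (i - 1)"
      and ?A = "\<lambda>i. if i = 1 then B else A (i - 1)"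
    have cones: "?p (Suc i) \<in> Mor C (?X (Suc i)) (?X i) \<and> is_cone C (?p (Suc i)) (?A (Suc i)) \<and>
           \<not> zero_object C (?A (Suc i)) \<and> ?A (Suc i) \<in> Part T ((a # s) ! i)"
      if "i < length (a # s)" for i
      using step.hyps IH(1) IH(3)[of "i - 1"] that by (cases i) auto
    have "?X 0 = x" "zero_object C (?X (length (a # s)))" using IH by simp_all
    with cones show ?case
      by (intro exI[of _ ?X] exI[of _ ?p] exI[of _ ?A] conjI[OF _ conjI] allI impI) simp_all
  qed
  then obtain Xs p A where X: "Xs 0 = x" "zero_object C (Xs (length s))"
    "\<And>i. i < length s \<Longrightarrow> p (Suc i) \<in> Mor C (Xs (Suc i)) (Xs i) \<and>
       is_cone C (p (Suc i)) (A (Suc i)) \<and>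
       \<not> zero_object C (A (Suc i)) \<and> A (Suc i) \<in> Part T (s ! i)"
    by blast
  \<comment> \<open>List positions start at 0 but factors at 1, so the index of the factor
    \<open>A i\<close> is \<open>s ! (i - 1)\<close>.\<close>
  have cones: "p i \<in> Mor C (Xs i) (Xs (i - 1)) \<and> is_cone C (p i) (A i) \<and>
      \<not> zero_object C (A i) \<and> s ! (i - 1) \<in> Idx T \<and> A i \<in> Part T (s ! (i - 1))"
    if "i \<in> {1..length s}" for i
  proof -
    have i: "i - 1 < length s" "Suc (i - 1) = i" using that by auto
    then have "s ! (i - 1) \<in> Idx T" using assms(2) nth_mem by blast
    then show ?thesis using X(3)[OF i(1)] unfolding i(2) by blast
  qed
  have lt: "below T (s ! (i - 1)) (s ! (i + 1 - 1))" if "i \<in> {1..<length s}" for i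
    using assms(3) that by (auto simp: sorted_wrt_iff_nth_less)
  show ?thesis
    unfolding has_filtration_def
    by (rule exI[of _ "length s"], rule exI[of _ Xs], rule exI[of _ p], rule exI[of _ A],
        rule exI[of _ "\<lambda>i. s ! (i - 1)"])
      (intro conjI[OF X(1) conjI[OF X(2) conjI]] ballI cones lt)
qed

section \<open>Finite t-stabilities: the order automorphism, the shift and Hom vanishing\<close>

lemma nonpos_Mor_vanish_mono:
  "nonpos_Mor_vanish C S T \<Longrightarrow> S' \<subseteq> S \<Longrightarrow> T' \<subseteq> T \<Longrightarrow> nonpos_Mor_vanish C S' T'"
  unfolding nonpos_Mor_vanish_def by blast

text \<open>The map \<open>t\<close> carries the up-set of \<open>a\<close> bijectively onto the
  up-set of \<open>t a\<close>, which is contained in the former. By finiteness the two are equal,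
  so \<open>a\<close> lies above \<open>t a\<close> as well.\<close>

lemma finite_increasing_order_automorphism_id:
  assumes lin: "linear_order_on A r" and fin: "finite A" and aut: "order_automorphism A r t"
    and inc: "\<And>a. a \<in> A \<Longrightarrow> (a, t a) \<in> r" and a: "a \<in> A"
  shows "t a = a"
proof -
  define U where "U b = {c \<in> A. (b, c) \<in> r}" for b
  have bij: "bij_betw t A A" using aut by (simp add: order_automorphism_def)
  have ta: "t a \<in> A" using bij a bij_betwE by metis
  have "t ` U a = U (t a)"
  proof
    show "t ` U a \<subseteq> U (t a)"
      using aut a bij_betwE[OF bij] unfolding U_def order_automorphism_def by auto
    show "U (t a) \<subseteq> t ` U a"
    proof
      fix c assume c: "c \<in> U (t a)"
      then obtain b where b: "b \<in> A" "c = t b"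
        using bij by (auto simp: U_def bij_betw_def)
      then show "c \<in> t ` U a"
        using c aut a unfolding U_def order_automorphism_def by auto
    qed
  qed
  moreover have "inj_on t (U a)"
    using bij by (auto simp: U_def bij_betw_def intro: inj_on_subset)
  ultimately have "card (U (t a)) = card (U a)" using card_image by metis
  moreover have "U (t a) \<subseteq> U a"
    using inc[OF a] lin unfolding U_def order_on_defs by (auto dest: transD)
  moreover have "finite (U a)" using fin by (simp add: U_def)
  ultimately have eq: "U (t a) = U a" using card_subset_eq by metis
  have "a \<in> U a" using a lin by (auto simp: U_def order_on_defs refl_on_def)
  then have "a \<in> U (t a)" by (simp only: eq)
  then have "(t a, a) \<in> r" by (simp add: U_def)
  then show ?thesis using inc[OF a] lin unfolding order_on_defs by (blast dest: antisymD)
qed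

lemma finite_t_stability_Tau:
  assumes "finite_t_stability C T" "a \<in> Idx T"
  shows "Tau T a = a"
  using assms finite_increasing_order_automorphism_id
  unfolding finite_t_stability_def t_stability_def by metis

lemma finite_t_stability_shift:
  assumes "finite_t_stability C T" "a \<in> Idx T"
  shows "shift_subcategory C (Part T a) = Part T a"
  using assms finite_t_stability_Tau[OF assms]
  unfolding finite_t_stability_def t_stability_def by metis

lemma finite_t_stability_vanish:
  assumes "finite_t_stability C T" "a \<in> Idx T" "b \<in> Idx T" "below T a b"
    "x \<in> Part T b" "y \<in> Part T a"
  shows "Mor_vanish C x y"
proof -
  have v: "nonpos_Mor_vanish C (Part T b) (Part T a)"
    using assms unfolding finite_t_stability_def t_stability_def by blast
  show ?thesis unfolding Mor_vanish_def
  proof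
    fix f assume f: "f \<in> Mor C x y"
    then have "f \<in> graded_Mor C 0 x y" by (simp add: graded_Mor_def)
    then have "f = Zero C (Dom C f) (Cod C f)"
      using v assms unfolding nonpos_Mor_vanish_def by blast
    then show "f = Zero C x y" using f by (simp add: Mor_Dom Mor_Cod)
  qed
qed

section \<open>Concatenating filtrations, and the parts of a finite t-stability\<close>

context triangulated_category
begin

lemma triangulated_subcategoryD:
  assumes "triangulated_subcategory C S"
  shows "S \<subseteq> Obj C"
    "x \<in> S \<Longrightarrow> isomorphic C x y \<Longrightarrow> y \<in> S"
    "zero_object C z \<Longrightarrow> z \<in> S"
    "x \<in> S \<Longrightarrow> ShO C x \<in> S"
    "exact_triangle C x y z \<Longrightarrow> x \<in> S \<Longrightarrow> z \<in> S \<Longrightarrow> y \<in> S"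
proof -
  show sub: "S \<subseteq> Obj C"
    using assms by (simp add: triangulated_subcategory_def strictly_full_def)
  show iso: "y \<in> S" if "x \<in> S" "isomorphic C x y" for x y
    using assms that isomorphic_Obj unfolding triangulated_subcategory_def strictly_full_def
    by blast
  show "z \<in> S" if "zero_object C z"
    using assms that iso zero_objects_isomorphic unfolding triangulated_subcategory_def by blast
  show "x \<in> S \<Longrightarrow> ShO C x \<in> S" using assms sub unfolding triangulated_subcategory_def by blast
  show "y \<in> S" if "exact_triangle C x y z" "x \<in> S" "z \<in> S"
    using assms that Mor_Dom Mor_Cod
    unfolding triangulated_subcategory_def extension_closed_def exact_triangle_def by metis
qed

text \<open>Only the outermost triangle is altered: its middle vertex is exchanged, while the fibre
  and the cone stay.\<close>

lemma filtered_isomorphic: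
  assumes "filtered C S s x" "isomorphic C x y" shows "filtered C S s y"
  using assms(1)
proof cases
  case zero
  then show ?thesis using assms(2) isomorphic_zero_object filtered.zero by metis
next
  case (step p w A a t)
  then have w: "exact_triangle C w x A" using is_cone_exact_triangle by blast
  then have "exact_triangle C w y A"
    using exact_triangle_isomorphic isomorphic_refl assms(2) exact_triangle_Obj by blast
  then obtain q where "q \<in> Mor C w y" "is_cone C q A"
    unfolding exact_triangle_def is_cone_def using Mor_Cod by metis
  then show ?thesis using step filtered.step by metis
qed

text \<open>Induction on the filtration of \<open>a\<close>: \<open>exact_triangle_refine\<close>
  takes the first factor of \<open>a\<close> off \<open>x\<close> and leaves an extension of the
  rest of \<open>a\<close> by \<open>x'\<close>. In the base case \<open>x\<close> is isomorphic to
  \<open>x'\<close>.\<close>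

lemma filtered_append:
  assumes "filtered C S s a" "exact_triangle C x' x a" "filtered C S s' x'"
  shows "filtered C S (s @ s') x"
  using assms
proof (induction arbitrary: x rule: filtered.induct)
  case (zero a)
  then show ?case using exact_triangle_zero_isomorphic filtered_isomorphic by (metis append_Nil)
next
  case (step p b a A i s)
  then have "exact_triangle C b a A" using is_cone_exact_triangle by blast
  then obtain y where y: "exact_triangle C y x A" "exact_triangle C x' y b"
    using exact_triangle_refine step.prems(1) by blast
  then have "filtered C S (s @ s') y" using step by blast
  moreover obtain q where "q \<in> Mor C y x" "is_cone C q A"
    using y(1) unfolding exact_triangle_def is_cone_def using Mor_Cod by metis
  ultimately show ?case using step.hyps filtered.step by (metis append_Cons)
qed

text \<open>Each factor is replaced by its own filtration and \<open>filtered_append\<close> joins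
  the pieces. The set \<open>I a\<close> is the block of indices allowed when refining
  \<open>a\<close>; the last assumption orders the blocks, so the concatenation is again
  sorted.\<close>

lemma filtered_refine:
  assumes "filtered C Q s x" "sorted_wrt R s"
    and "\<And>a A. a \<in> set s \<Longrightarrow> A \<in> Q a \<Longrightarrow> \<not> zero_object C A \<Longrightarrow>
      \<exists>t. filtered C P t A \<and> set t \<subseteq> I a \<and> sorted_wrt lt t"
    and "\<And>a b i j. a \<in> set s \<Longrightarrow> b \<in> set s \<Longrightarrow> R a b \<Longrightarrow> i \<in> I a \<Longrightarrow> j \<in> I b \<Longrightarrow> lt i j"
  shows "\<exists>t. filtered C P t x \<and> set t \<subseteq> (\<Union>a \<in> set s. I a) \<and> sorted_wrt lt t"
  using assms
proof (induction rule: filtered.induct)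
  case (zero x)
  then show ?case using filtered.zero by (intro exI[of _ "[]"]) simp
next
  case (step p y x A a s)
  obtain u where u: "filtered C P u A" "set u \<subseteq> I a" "sorted_wrt lt u"
    using step.prems(2)[of a A] step.hyps by auto
  have "\<exists>t. filtered C P t y \<and> set t \<subseteq> (\<Union>a \<in> set s. I a) \<and> sorted_wrt lt t"
  proof (rule step.IH)
    show "sorted_wrt R s" using step.prems(1) by simp
    show "\<exists>t. filtered C P t B \<and> set t \<subseteq> I c \<and> sorted_wrt lt t"
      if "c \<in> set s" "B \<in> Q c" "\<not> zero_object C B" for c B
      using step.prems(2)[of c B] that by simp
    show "lt i j" if "c \<in> set s" "b \<in> set s" "R c b" "i \<in> I c" "j \<in> I b" for c b i j
      using step.prems(3)[of c b i j] that by simp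
  qed
  then obtain t where t: "filtered C P t y" "set t \<subseteq> (\<Union>a \<in> set s. I a)" "sorted_wrt lt t"
    by blast
  have "lt i j" if ij: "i \<in> set u" "j \<in> set t" for i j
  proof -
    obtain b where b: "b \<in> set s" "j \<in> I b" using ij t by blast
    then have "R a b" using step.prems(1) by simp
    then show ?thesis using step.prems(3)[of a b i j] b u ij by auto
  qed
  then have "sorted_wrt lt (u @ t)" using u t by (simp add: sorted_wrt_append)
  moreover have "filtered C P (u @ t) x"
    using filtered_append u t is_cone_exact_triangle step.hyps by blast
  moreover have "set (u @ t) \<subseteq> (\<Union>a \<in> set (a # s). I a)" using u t by auto
  ultimately show ?case by blast
qed

text \<open>Zero objects lie in \<open>T\<close> and every step of the filtration is an extension.
  Used to place a part inside each subcategory that contains its refinement.\<close>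

lemma filtered_closed:
  assumes "filtered C S s x" "triangulated_subcategory C T" "\<And>a. a \<in> set s \<Longrightarrow> S a \<subseteq> T"
  shows "x \<in> T"
  using assms
proof (induction rule: filtered.induct)
  case (zero x)
  then show ?case using triangulated_subcategoryD(3) by blast
next
  case (step p y x A a s)
  have "exact_triangle C y x A" using step.hyps is_cone_exact_triangle by blast
  moreover have "y \<in> T" "A \<in> T" using step by auto
  ultimately show ?case using triangulated_subcategoryD(5)[OF step.prems(1)] by blast
qed

text \<open>Devissage: vanishing spreads from the factors along the triangles.\<close>

lemma filtered_Mor_vanish:
  assumes "filtered C S s x" "w \<in> Obj C" "\<And>a y. a \<in> set s \<Longrightarrow> y \<in> S a \<Longrightarrow> Mor_vanish C y w"
  shows "Mor_vanish C x w"
  using assms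
proof (induction rule: filtered.induct)
  case (zero x)
  then show ?case using Mor_vanish_zero_left by blast
next
  case (step p y x A a s)
  have "exact_triangle C y x A" using step.hyps is_cone_exact_triangle by blast
  moreover have "Mor_vanish C y w" "Mor_vanish C A w" using step by auto
  ultimately show ?case using Mor_vanish_triangle_left by blast
qed

lemma filtered_Obj: "filtered C S s x \<Longrightarrow> x \<in> Obj C"
  by (induction rule: filtered.induct) (auto simp: zero_object_iff dest: Mor_Obj)

text \<open>The trivial order automorphism makes the part equal to its own shift; extension closure
  then also provides a zero object.\<close>

lemma finite_t_stability_triangulated_subcategory:
  assumes T: "finite_t_stability C T" and a: "a \<in> Idx T"
  shows "triangulated_subcategory C (Part T a)"
proof -
  let ?S = "Part T a"
  have sf: "strictly_full C ?S" and ext: "extension_closed C ?S"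
    and nz: "nonzero_subcategory C ?S"
    using assms unfolding finite_t_stability_def t_stability_def by blast+
  have sub: "?S \<subseteq> Obj C" using sf by (simp add: strictly_full_def)
  have sh: "shift_subcategory C ?S = ?S" using finite_t_stability_shift[OF assms] .
  have 1: "ShO C x \<in> ?S" if "x \<in> ?S" for x
    using sh that sub ShO_closed isomorphic_refl unfolding shift_subcategory_def by blast
  \<comment> \<open>\<open>ShO C x\<close> is isomorphic to the shift of some object of the part,
    and the shift reflects isomorphisms.\<close>
  have 2: "x \<in> ?S" if x: "x \<in> Obj C" "ShO C x \<in> ?S" for x
  proof -
    obtain y where y: "y \<in> ?S" "isomorphic C (ShO C y) (ShO C x)"
      using sh x(2) unfolding shift_subcategory_def by blast
    then have "isomorphic C y x" using isomorphic_ShO_cancel x(1) sub by blast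
    then show ?thesis using sf x(1) y(1) unfolding strictly_full_def by blast
  qed
  obtain x where x: "x \<in> ?S" using nz unfolding nonzero_subcategory_def by blast
  obtain z where z: "zero_object C z" using zero_object_exists by blast
  \<comment> \<open>Rotating the triangle on the identity of \<open>x\<close> exhibits a zero object
    as an extension of the shift of \<open>x\<close> by \<open>x\<close>.\<close>
  have "(Ident C x, Zero C x z, Zero C z (ShO C x)) \<in> Tri C" using Tri_Ident x sub z by blast
  then have "exact_triangle C x x z"
    using exact_triangleI[of "Ident C x" "Zero C x z"] Ident_closed[of x] Zero_closed[of x z]
      x sub z by (auto simp: zero_object_iff Mor_Dom Mor_Cod)
  then have "exact_triangle C x z (ShO C x)" using exact_triangle_rotate by blast
  then obtain f g h where "(f, g, h) \<in> Tri C" "Dom C f = x" "Cod C f = z" "Cod C g = ShO C x"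
    unfolding exact_triangle_def by (blast dest: Mor_Dom Mor_Cod)
  then have "z \<in> ?S" using ext x 1[OF x] unfolding extension_closed_def by metis
  then show ?thesis unfolding triangulated_subcategory_def using sf ext z 1 2 by blast
qed

text \<open>Each \<open>y\<close> in \<open>S\<close> is isomorphic to the shift of some
  \<open>w\<close> in \<open>S\<close>, and the shift is faithful and full on arrows from
  \<open>x\<close> to \<open>w\<close>.\<close>

lemma Mor_vanish_ShO_left:
  assumes S: "shift_subcategory C S = S" and x: "x \<in> Obj C"
    and sub: "S \<subseteq> Obj C" and v: "\<And>y. y \<in> S \<Longrightarrow> Mor_vanish C x y" and y: "y \<in> S"
  shows "Mor_vanish C (ShO C x) y"
proof -
  obtain w where w: "w \<in> S" "isomorphic C (ShO C w) y"
    using S y unfolding shift_subcategory_def by blast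
  then have "Mor_vanish C (ShO C x) (ShO C w)" using Mor_vanish_ShO_iff v x sub by blast
  then show ?thesis using Mor_vanish_isomorphic_right w(2) by blast
qed

text \<open>Membership is expressed by Hom vanishing because this passes to direct summands. For a
  nonzero \<open>x\<close> on the right, the index \<open>b\<close> of the first factor of a
  filtration is compared with \<open>a\<close>: equality forces the remainder to be zero, and the
  other two cases are contradictory.\<close>

lemma finite_t_stability_part_eq:
  assumes T: "finite_t_stability C T" and a: "a \<in> Idx T"
  shows "Part T a = {x \<in> Obj C.
    (\<forall>b \<in> Idx T. below T a b \<longrightarrow> (\<forall>w \<in> Part T b. Mor_vanish C w x)) \<and>
    (\<forall>b \<in> Idx T. below T b a \<longrightarrow> (\<forall>w \<in> Part T b. Mor_vanish C x w))}" (is "_ = ?R")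
proof
  note tri = finite_t_stability_triangulated_subcategory[OF T]
  show "Part T a \<subseteq> ?R"
    using finite_t_stability_vanish[OF T] a triangulated_subcategoryD(1)[OF tri] by blast
  show "?R \<subseteq> Part T a"
  proof
    fix x assume "x \<in> ?R"
    then have x: "x \<in> Obj C"
      and up: "\<And>b w. b \<in> Idx T \<Longrightarrow> below T a b \<Longrightarrow> w \<in> Part T b \<Longrightarrow> Mor_vanish C w x"
      and lo: "\<And>b w. b \<in> Idx T \<Longrightarrow> below T b a \<Longrightarrow> w \<in> Part T b \<Longrightarrow> Mor_vanish C x w"
      by auto
    have lin: "linear_order_on (Idx T) (Ord T)"
      using T by (simp add: finite_t_stability_def t_stability_def)
    have total: "b = a \<or> below T a b \<or> below T b a" if "b \<in> Idx T" for b
      using lin a that unfolding order_on_defs total_on_def below_def by blast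
    \<comment> \<open>All factors of \<open>u\<close> lie in parts above \<open>a\<close>, from
      which nothing maps to \<open>u\<close>; hence \<open>u\<close> has no nonzero
      endomorphism.\<close>
    have filt_zero: "zero_object C u"
      if u: "filtered C (Part T) t u" "\<And>b. b \<in> set t \<Longrightarrow> b \<in> Idx T \<and> below T a b"
        "\<And>b w. b \<in> Idx T \<Longrightarrow> below T a b \<Longrightarrow> w \<in> Part T b \<Longrightarrow> Mor_vanish C w u" for u t
      using filtered_Mor_vanish[OF u(1), of u] filtered_Obj u zero_object_iff_Mor_vanish by metis
    show "x \<in> Part T a"
    proof (cases "zero_object C x")
      case True
      then show ?thesis using triangulated_subcategoryD(3)[OF tri[OF a]] by blast
    next
      case False
      then have "has_filtration C T x"
        using T x unfolding finite_t_stability_def t_stability_def by blast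
      then obtain s where s: "filtered C (Part T) s x" "set s \<subseteq> Idx T" "sorted_wrt (below T) s"
        using has_filtrationD[OF lin] by blast
      from s(1) show ?thesis
      proof cases
        case zero
        with False show ?thesis by simp
      next
        case (step p y A b t)
        have t: "exact_triangle C y x A" using step is_cone_exact_triangle by blast
        note O = exact_triangle_Obj[OF t]
        have bI: "b \<in> Idx T" and tb: "\<And>c. c \<in> set t \<Longrightarrow> c \<in> Idx T \<and> below T b c"
          using s step by auto
        note trb = triangulated_subcategoryD[OF tri[OF bI]]
        consider "b = a" | "below T a b" | "below T b a" using total[OF bI] by blast
        then show ?thesis
        proof cases
          case 1
          \<comment> \<open>Two rotations place the shift of \<open>y\<close> between
            \<open>A\<close> and the shift of \<open>x\<close>; neither receives arrows from the
            shift of \<open>w\<close>. So \<open>filt_zero\<close> applies to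
            \<open>y\<close>.\<close>
          have "Mor_vanish C w y" if c: "c \<in> Idx T" "below T a c" "w \<in> Part T c" for c w
          proof -
            have w: "w \<in> Obj C" "ShO C w \<in> Part T c"
              using triangulated_subcategoryD[OF tri[OF c(1)]] c by blast+
            have "Mor_vanish C (ShO C w) A"
              using finite_t_stability_vanish[OF T a c(1,2) w(2)] step 1 by simp
            moreover have "Mor_vanish C (ShO C w) (ShO C x)"
              using up c w O Mor_vanish_ShO_iff by blast
            ultimately have "Mor_vanish C (ShO C w) (ShO C y)"
              using Mor_vanish_triangle_right exact_triangle_rotate[OF exact_triangle_rotate[OF t]]
              by blast
            then show ?thesis using Mor_vanish_ShO_iff O w by blast
          qed
          then have "zero_object C y" using filt_zero[OF step(6)] tb 1 by blast
          then show ?thesis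
            using triangulated_subcategoryD(3,5)[OF tri[OF a]] t step 1 by blast
        next
          case 2
          \<comment> \<open>The first index is the smallest one, so every factor of \<open>x\<close>
            lies above \<open>a\<close> and \<open>x\<close> itself would be zero.\<close>
          then have "below T a c" if "c \<in> set s" for c
            using that step tb transpD[OF transp_below[OF lin]] by (metis set_ConsD)
          then have "zero_object C x" using filt_zero[OF s(1)] s(2) up by blast
          with False show ?thesis by simp
        next
          case 3
          \<comment> \<open>The factors of \<open>y\<close> lie above \<open>b\<close>, so neither
            the shift of \<open>y\<close> nor \<open>x\<close> maps to \<open>A\<close>. The rotated
            triangle then makes \<open>A\<close> zero, although factors are nonzero.\<close>
          have "Mor_vanish C y w" if "w \<in> Part T b" for w
            using filtered_Mor_vanish[OF step(6)] that trb(1) finite_t_stability_vanish[OF T bI] tb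
            by blast
          then have "Mor_vanish C (ShO C y) A"
            using Mor_vanish_ShO_left[OF finite_t_stability_shift[OF T bI] O(1) trb(1)] step by blast
          moreover have "Mor_vanish C x A" using lo[OF bI 3] step by blast
          ultimately have "Mor_vanish C A A"
            using Mor_vanish_triangle_left exact_triangle_rotate[OF t] by blast
          then show ?thesis using step O zero_object_iff_Mor_vanish by blast
        qed
      qed
    qed
  qed
qed

text \<open>Both vanishing conditions in \<open>finite_t_stability_part_eq\<close> are inherited by
  summands.\<close>

lemma finite_t_stability_summand_closed:
  assumes T: "finite_t_stability C T" and a: "a \<in> Idx T"
  shows "summand_closed C (Part T a)"
  unfolding summand_closed_def
proof (intro allI impI)
  fix x y z assume b: "biproduct C x y z" and z: "z \<in> Part T a"
  have "x \<in> Obj C" using b by (simp add: biproduct_def)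
  then show "x \<in> Part T a"
    using z Mor_vanish_summand[OF b] unfolding finite_t_stability_part_eq[OF assms] by blast
qed

end

section \<open>A t-stability on a triangulated subcategory, seen in the ambient category\<close>

lemma full_subcategory_simps [simp]:
  "Obj (full_subcategory C S) = S"
  "Dom (full_subcategory C S) = Dom C"
  "Cod (full_subcategory C S) = Cod C"
  "Ident (full_subcategory C S) = Ident C"
  "Comp (full_subcategory C S) = Comp C"
  "Zero (full_subcategory C S) = Zero C"
  "ShO (full_subcategory C S) = ShO C"
  by (simp_all add: full_subcategory_def)

lemma Mor_full_subcategory:
  "Mor (full_subcategory C S) x y = (if x \<in> S \<and> y \<in> S then Mor C x y else {})"
  by (auto simp: Mor_def full_subcategory_def)

lemma Tri_full_subcategoryD:
  assumes "(f, g, h) \<in> Tri (full_subcategory C S)"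
  shows "(f, g, h) \<in> Tri C" "Dom C f \<in> S" "Cod C f \<in> S" "Cod C g \<in> S"
  using assms by (auto simp: full_subcategory_def)

context triangulated_category
begin

context
  fixes S assumes tri: "triangulated_subcategory C S"
begin

lemma isomorphic_full_subcategory:
  assumes "x \<in> S" "y \<in> S"
  shows "isomorphic (full_subcategory C S) x y \<longleftrightarrow> isomorphic C x y"
  unfolding isomorphic_iff using assms
  by (force simp: isomorphic_def isomorphism_def Mor_def full_subcategory_def)

lemma zero_object_full_subcategory:
  assumes "z \<in> S" shows "zero_object (full_subcategory C S) z \<longleftrightarrow> zero_object C z"
proof
  note sub = triangulated_subcategoryD(1)[OF tri]
  assume "zero_object C z"
  then show "zero_object (full_subcategory C S) z"
    using sub assms unfolding zero_object_def by (simp add: Mor_full_subcategory subset_iff)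
next
  note sub = triangulated_subcategoryD(1)[OF tri]
  assume "zero_object (full_subcategory C S) z"
  \<comment> \<open>By fullness the endomorphisms of \<open>z\<close> are the same in both
    categories, and the identity being zero detects zero objects in the ambient one.\<close>
  then have "\<exists>!f. f \<in> Mor C z z"
    using assms unfolding zero_object_def by (simp add: Mor_full_subcategory)
  moreover have "Ident C z \<in> Mor C z z" "Zero C z z \<in> Mor C z z"
    using Ident_closed Zero_closed sub assms by blast+
  ultimately show "zero_object C z" unfolding zero_object_iff using sub assms by blast
qed

lemma filtered_full_subcategory:
  assumes "filtered (full_subcategory C S) P s x"
  shows "filtered C P s x"
  using assms
proof (induction rule: filtered.induct)
  case (zero x)
  then have "x \<in> S" by (simp add: zero_object_def)
  then show ?case using zero zero_object_full_subcategory filtered.zero by metis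
next
  case (step p y x A a s)
  obtain g h where "(p, g, h) \<in> Tri (full_subcategory C S)" "Cod C g = A"
    using step.hyps(2) by (auto simp: is_cone_def)
  then have "is_cone C p A" "A \<in> S" unfolding is_cone_def using Tri_full_subcategoryD by metis+
  moreover have "p \<in> Mor C y x"
    using step.hyps(1) by (auto simp: Mor_full_subcategory split: if_splits)
  ultimately show ?case using step zero_object_full_subcategory filtered.step by metis
qed

lemma funpow_ShO_closed: "x \<in> S \<Longrightarrow> (ShO C ^^ k) x \<in> S"
  using triangulated_subcategoryD(4)[OF tri] by (induction k) auto

text \<open>Whatever the sign of \<open>k\<close>, only nonnegative powers of the shift occur, and
  these preserve \<open>S\<close>.\<close>

lemma graded_Mor_full_subcategory:
  "x \<in> S \<Longrightarrow> y \<in> S \<Longrightarrow> graded_Mor (full_subcategory C S) k x y = graded_Mor C k x y"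
  by (simp add: graded_Mor_def Mor_full_subcategory funpow_ShO_closed)

context
  fixes T :: "('i, 'o) stability_data"
  assumes T: "finite_t_stability (full_subcategory C S) T"
begin

lemma subcategory_part_subset: "a \<in> Idx T \<Longrightarrow> Part T a \<subseteq> S"
  using T unfolding finite_t_stability_def t_stability_def strictly_full_def by simp

lemma subcategory_part_strictly_full:
  assumes "a \<in> Idx T" shows "strictly_full C (Part T a)"
proof -
  have *: "\<forall>x \<in> Part T a. \<forall>y \<in> S. isomorphic (full_subcategory C S) x y \<longrightarrow> y \<in> Part T a"
    using T assms unfolding finite_t_stability_def t_stability_def strictly_full_def by simp
  show ?thesis unfolding strictly_full_def
    using * subcategory_part_subset[OF assms] triangulated_subcategoryD(1,2)[OF tri]
      isomorphic_full_subcategory by (meson subsetD subset_trans)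
qed

lemma subcategory_part_extension_closed:
  assumes "a \<in> Idx T" shows "extension_closed C (Part T a)"
  unfolding extension_closed_def
proof (intro allI impI)
  fix f g h assume t: "(f, g, h) \<in> Tri C" and f: "Dom C f \<in> Part T a" and g: "Cod C g \<in> Part T a"
  note shape = Tri_shape[OF t, unfolded triangle_shape_def]
  have S: "Dom C f \<in> S" "Cod C g \<in> S" using f g subcategory_part_subset[OF assms] by blast+
  \<comment> \<open>The middle vertex lies in \<open>S\<close> because \<open>S\<close> is closed
    under extensions, so the whole triangle lives in the subcategory.\<close>
  then have "Cod C f \<in> S" "ShO C (Dom C f) \<in> S"
    using triangulated_subcategoryD(4,5)[OF tri] exact_triangleI[OF t] by blast+
  then have "(f, g, h) \<in> Tri (full_subcategory C S)"
    using t shape S by (simp add: full_subcategory_def)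
  moreover have "extension_closed (full_subcategory C S) (Part T a)"
    using T assms unfolding finite_t_stability_def t_stability_def by blast
  ultimately show "Cod C f \<in> Part T a"
    using f g unfolding extension_closed_def by simp blast
qed

lemma subcategory_part_nonzero:
  assumes "a \<in> Idx T" shows "nonzero_subcategory C (Part T a)"
proof -
  have "nonzero_subcategory (full_subcategory C S) (Part T a)"
    using T assms unfolding finite_t_stability_def t_stability_def by blast
  then show ?thesis unfolding nonzero_subcategory_def
    using zero_object_full_subcategory subcategory_part_subset[OF assms] by blast
qed

text \<open>An ambient object isomorphic to a shift of an object of the part already lies in
  \<open>S\<close>, so the shift formed inside and outside agree; finiteness makes the inner one
  equal to the part.\<close>

lemma subcategory_part_shift:
  assumes "a \<in> Idx T" shows "shift_subcategory C (Part T a) = Part T a"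
proof -
  note sub = subcategory_part_subset[OF assms]
  have "shift_subcategory C (Part T a) = shift_subcategory (full_subcategory C S) (Part T a)"
  proof (intro equalityI subsetI)
    fix y assume "y \<in> shift_subcategory C (Part T a)"
    then obtain x where x: "x \<in> Part T a" "isomorphic C (ShO C x) y"
      unfolding shift_subcategory_def by blast
    then have sx: "ShO C x \<in> S" using triangulated_subcategoryD(4)[OF tri] sub by blast
    then have "y \<in> S" using triangulated_subcategoryD(2)[OF tri] x by blast
    then show "y \<in> shift_subcategory (full_subcategory C S) (Part T a)"
      unfolding shift_subcategory_def using x sx isomorphic_full_subcategory by auto
  next
    fix y assume "y \<in> shift_subcategory (full_subcategory C S) (Part T a)"
    then obtain x where x: "x \<in> Part T a" "isomorphic (full_subcategory C S) (ShO C x) y"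
      and y: "y \<in> S" unfolding shift_subcategory_def by auto
    have "ShO C x \<in> S" using triangulated_subcategoryD(4)[OF tri] sub x by blast
    then have "isomorphic C (ShO C x) y" using x y isomorphic_full_subcategory by blast
    then show "y \<in> shift_subcategory C (Part T a)"
      unfolding shift_subcategory_def using x isomorphic_Obj by blast
  qed
  then show ?thesis using finite_t_stability_shift[OF T assms] by simp
qed

lemma subcategory_nonpos_Mor_vanish:
  assumes "a \<in> Idx T" "b \<in> Idx T" "below T a b"
  shows "nonpos_Mor_vanish C (Part T b) (Part T a)"
proof -
  have v: "nonpos_Mor_vanish (full_subcategory C S) (Part T b) (Part T a)"
    using T assms unfolding finite_t_stability_def t_stability_def by blast
  show ?thesis unfolding nonpos_Mor_vanish_def
  proof (intro ballI allI impI)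
    fix x y k f
    assume xy: "x \<in> Part T b" "y \<in> Part T a" and k: "k \<le> 0" and f: "f \<in> graded_Mor C k x y"
    have "x \<in> S" "y \<in> S" using xy subcategory_part_subset assms by blast+
    then have "f \<in> graded_Mor (full_subcategory C S) k x y"
      using f graded_Mor_full_subcategory by simp
    then show "f = Zero C (Dom C f) (Cod C f)"
      using v xy k unfolding nonpos_Mor_vanish_def by simp
  qed
qed

text \<open>Zero objects are included, with the empty list, so that later arguments need no separate
  case for them.\<close>

lemma subcategory_filtration:
  assumes x: "x \<in> S"
  obtains s where "filtered C (Part T) s x" "set s \<subseteq> Idx T" "sorted_wrt (below T) s"
proof (cases "zero_object C x")
  case True
  then show ?thesis using that[of "[]"] by (simp add: filtered.zero)
next
  case False
  have "linear_order_on (Idx T) (Ord T)"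
    using T by (simp add: finite_t_stability_def t_stability_def)
  moreover have "has_filtration (full_subcategory C S) T x"
    using T x False zero_object_full_subcategory
    unfolding finite_t_stability_def t_stability_def by simp
  ultimately show ?thesis using has_filtrationD that filtered_full_subcategory by metis
qed

end

end

end

section \<open>The refined t-stability on the union of the index sets\<close>

theorem proposition3p7:
  fixes K :: "('k, 'e) ring_scheme"
    and D :: "('o, 'm, 'k) tricat"
    and n :: nat
    and Q :: "nat \<Rightarrow> 'o set"
    and \<tau> :: "nat \<Rightarrow> nat"
    and I :: "nat \<Rightarrow> 'i set"
    and le :: "nat \<Rightarrow> 'i rel"
    and P :: "'i \<Rightarrow> 'o set"
    and \<sigma> :: "nat \<Rightarrow> 'i \<Rightarrow> 'i"
    and \<Psi> :: "'i set"
    and le\<Psi> :: "'i rel"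
  assumes "algebraically_closed K"
    and "triangulated_category K D"
    and "finite_t_stability D
           \<lparr>Idx = {1..n}, Ord = {(a, b). a \<in> {1..n} \<and> b \<in> {1..n} \<and> a \<le> b},
            Part = Q, Tau = \<tau>\<rparr>"
    and "\<And>i. i \<in> {1..n} \<Longrightarrow>
           finite_t_stability (full_subcategory D (Q i))
             \<lparr>Idx = I i, Ord = le i, Part = P, Tau = \<sigma> i\<rparr>"
    and "\<Psi> = (\<Union>i \<in> {1..n}. I i)"
    and "linear_order_on \<Psi> le\<Psi>"
    and "\<And>i. i \<in> {1..n} \<Longrightarrow> le i = Restr le\<Psi> (I i)"
    and "\<And>i j a b. i \<in> {1..n} \<Longrightarrow> j \<in> {1..n} \<Longrightarrow> i < j \<Longrightarrow> a \<in> I i \<Longrightarrow> b \<in> I j \<Longrightarrow>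
           (a, b) \<in> le\<Psi> \<and> a \<noteq> b"
  shows "finite_t_stability D \<lparr>Idx = \<Psi>, Ord = le\<Psi>, Part = P, Tau = id\<rparr> \<and>
         finer D \<lparr>Idx = \<Psi>, Ord = le\<Psi>, Part = P, Tau = id\<rparr>
           \<lparr>Idx = {1..n}, Ord = {(a, b). a \<in> {1..n} \<and> b \<in> {1..n} \<and> a \<le> b},
            Part = Q, Tau = \<tau>\<rparr>"
proof -
  interpret triangulated_category K D by fact
  \<comment> \<open>\<open>T\<close> is the coarse t-stability, \<open>U i\<close> the given one on
    its part \<open>Q i\<close>, and \<open>V\<close> the candidate on the union.\<close>
  define T where "T = \<lparr>Idx = {1..n}, Ord = {(a, b). a \<in> {1..n} \<and> b \<in> {1..n} \<and> a \<le> b},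
            Part = Q, Tau = \<tau>\<rparr>"
  define U where "U i = \<lparr>Idx = I i, Ord = le i, Part = P, Tau = \<sigma> i\<rparr>" for i
  define V where "V = \<lparr>Idx = \<Psi>, Ord = le\<Psi>, Part = P, Tau = id :: 'i \<Rightarrow> 'i\<rparr>"
  have T_simps [simp]: "Idx T = {1..n}" "Part T = Q" "Tau T = \<tau>"
    "Ord T = {(a, b). a \<in> {1..n} \<and> b \<in> {1..n} \<and> a \<le> b}"
    and U_simps [simp]: "\<And>i. Idx (U i) = I i" "\<And>i. Part (U i) = P" "\<And>i. Ord (U i) = le i"
    and V_simps [simp]: "Idx V = \<Psi>" "Part V = P" "Ord V = le\<Psi>" "Tau V = id"
    by (simp_all add: T_def U_def V_def)
  have T: "finite_t_stability D T" using assms(3) by (simp add: T_def)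
  have U: "finite_t_stability (full_subcategory D (Q i)) (U i)" if "i \<in> {1..n}" for i
    using assms(4)[OF that] by (simp add: U_def)
  have tri: "triangulated_subcategory D (Q i)" if "i \<in> {1..n}" for i
    using finite_t_stability_triangulated_subcategory[OF T, of i] that by simp
  have sub: "P a \<subseteq> Q i" if "i \<in> {1..n}" "a \<in> I i" for i a
    using subcategory_part_subset[OF tri[OF that(1)] U[OF that(1)], of a] that(2) by simp
  have below_T: "below T i j \<longleftrightarrow> i \<in> {1..n} \<and> j \<in> {1..n} \<and> i < j" for i j
    by (auto simp: below_def)
  have below_U: "below (U i) a b \<longleftrightarrow> below V a b \<and> a \<in> I i \<and> b \<in> I i" if "i \<in> {1..n}" for i a b
    using assms(7)[OF that] by (auto simp: below_def)
  have cross: "below V a b" if "i \<in> {1..n}" "j \<in> {1..n}" "i < j" "a \<in> I i" "b \<in> I j" for i j a b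
    using assms(8)[OF that] by (simp add: below_def)
  have lin: "linear_order_on \<Psi> le\<Psi>" by fact
  have mono: "i \<le> j" if "i \<in> {1..n}" "j \<in> {1..n}" "a \<in> I i" "b \<in> I j" "below V a b" for i j a b
  proof (rule ccontr)
    assume "\<not> i \<le> j"
    then have "below V b a" using cross[of j i b a] that by simp
    then show False using that(5) lin unfolding below_def order_on_defs
      by (auto dest: antisymD)
  qed
  \<comment> \<open>A common element of two different blocks would lie strictly below
    itself.\<close>
  have unique: "i = j" if "i \<in> {1..n}" "j \<in> {1..n}" "a \<in> I i" "a \<in> I j" for i j a
    using cross[of i j a a] cross[of j i a a] that by (cases i j rule: linorder_cases) (auto simp: below_def)
  have Psi: "\<Psi> = (\<Union>i \<in> {1..n}. I i)" by fact
  have PsiE: "\<exists>i \<in> {1..n}. a \<in> I i" if "a \<in> \<Psi>" for a using that Psi by blast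
  have filt: "\<exists>t. filtered D P t A \<and> set t \<subseteq> I i \<and> sorted_wrt (below V) t"
    if i: "i \<in> {1..n}" and A: "A \<in> Q i" for i A
  proof -
    obtain t where t: "filtered D P t A" "set t \<subseteq> I i" "sorted_wrt (below (U i)) t"
      using subcategory_filtration[OF tri[OF i] U[OF i] A] by auto
    then have "sorted_wrt (below V) t"
      using below_U[OF i] by (auto elim: sorted_wrt_mono_rel[rotated])
    with t show ?thesis by blast
  qed
  have stab: "t_stability D V" unfolding t_stability_def
  proof (intro conjI ballI impI)
    show "linear_order_on (Idx V) (Ord V)" using lin by simp
    show "order_automorphism (Idx V) (Ord V) (Tau V)" by (simp add: order_automorphism_def)
  next
    fix a assume "a \<in> Idx V"
    then obtain i where i: "i \<in> {1..n}" "a \<in> I i" using PsiE by (metis V_simps(1))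
    note ctx = tri[OF i(1)] U[OF i(1)]
    show "strictly_full D (Part V a)" "extension_closed D (Part V a)"
      "nonzero_subcategory D (Part V a)"
      using subcategory_part_strictly_full[OF ctx, of a]
        subcategory_part_extension_closed[OF ctx, of a]
        subcategory_part_nonzero[OF ctx, of a] i by simp_all
    show "Part V (Tau V a) = shift_subcategory D (Part V a)"
      using subcategory_part_shift[OF ctx, of a] i by simp
    show "(a, Tau V a) \<in> Ord V"
      using \<open>a \<in> Idx V\<close> lin by (simp add: order_on_defs refl_on_def)
  next
    fix a b assume ab: "a \<in> Idx V" "b \<in> Idx V" "below V a b"
    then obtain i j where i: "i \<in> {1..n}" "a \<in> I i" and j: "j \<in> {1..n}" "b \<in> I j"
      using PsiE by (metis V_simps(1))
    show "nonpos_Mor_vanish D (Part V b) (Part V a)"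
    \<comment> \<open>Within one block the vanishing comes from \<open>U i\<close>; across blocks it
      comes from the coarse parts, which contain the fine ones.\<close>
    proof (cases "i = j")
      case True
      then show ?thesis
        using subcategory_nonpos_Mor_vanish[OF tri[OF i(1)] U[OF i(1)], of a b]
          below_U[OF i(1)] i(2) j(2) ab(3) by simp
    next
      case False
      then have "below T i j"
        unfolding below_T using mono[OF i(1) j(1) i(2) j(2) ab(3)] i(1) j(1) by simp
      then have "nonpos_Mor_vanish D (Q j) (Q i)"
        using T i j unfolding finite_t_stability_def t_stability_def by simp
      then show ?thesis
        using nonpos_Mor_vanish_mono sub[OF i] sub[OF j] by simp
    qed
  next
    fix x assume x: "x \<in> Obj D" "\<not> zero_object D x"
    have "linear_order_on (Idx T) (Ord T)" "has_filtration D T x"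
      using T x unfolding finite_t_stability_def t_stability_def by blast+
    then obtain s where s: "filtered D Q s x" "set s \<subseteq> {1..n}" "sorted_wrt (below T) s"
      using has_filtrationD T_simps(1,2) by metis
    \<comment> \<open>The coarse filtration of \<open>x\<close> is refined factor by factor, with
      \<open>I i\<close> as the block of indices for the factor \<open>i\<close>.\<close>
    obtain t where "filtered D P t x" "set t \<subseteq> (\<Union>i \<in> set s. I i)" "sorted_wrt (below V) t"
    proof (rule exE[OF filtered_refine[OF s(1,3)]])
      show "\<exists>t. filtered D P t A \<and> set t \<subseteq> I i \<and> sorted_wrt (below V) t"
        if "i \<in> set s" "A \<in> Q i" for i A
        using filt that s(2) by blast
      show "below V a b" if "i \<in> set s" "j \<in> set s" "below T i j" "a \<in> I i" "b \<in> I j" for i j a b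
        using cross that below_T by blast
    qed (use that in blast)
    moreover from this have "set t \<subseteq> \<Psi>" using s(2) Psi by blast
    ultimately show "has_filtration D V x" using has_filtrationI[of D V t x] by simp
  qed
  have "finite (I i)" if "i \<in> {1..n}" for i using U[OF that] by (simp add: finite_t_stability_def)
  then have fin: "finite_t_stability D V"
    using stab Psi by (simp add: finite_t_stability_def)
  \<comment> \<open>Makes the map of index sets surjective. Over an empty block every object of
    \<open>Q i\<close> would be filtered by the empty list and hence be zero.\<close>
  have nonempty: "I i \<noteq> {}" if i: "i \<in> {1..n}" for i
  proof
    assume "I i = {}"
    have "nonzero_subcategory D (Q i)"
      using T i unfolding finite_t_stability_def t_stability_def by simp
    then obtain x where x: "x \<in> Q i" "\<not> zero_object D x"
      unfolding nonzero_subcategory_def by blast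
    have "filtered D P [] x" using filt[OF i x(1)] \<open>I i = {}\<close> by auto
    then show False using x(2) by cases simp
  qed
  \<comment> \<open>The map sends an index to the number of its block, which \<open>unique\<close>
    shows to be well defined.\<close>
  define r where "r a = (THE i. i \<in> {1..n} \<and> a \<in> I i)" for a
  have r: "r a = i" if "i \<in> {1..n}" "a \<in> I i" for a i
    unfolding r_def using that unique by blast
  have fibre: "{a \<in> \<Psi>. r a = i} = I i" if "i \<in> {1..n}" for i
    using that PsiE r Psi by blast
  have gen: "Q i = generated_subcategory D (\<Union>a \<in> I i. P a)" if i: "i \<in> {1..n}" for i
  proof
    \<comment> \<open>\<open>Q i\<close> is itself one of the subcategories that are
      intersected.\<close>
    have "summand_closed D (Q i)" using finite_t_stability_summand_closed[OF T, of i] i by simp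
    moreover have "(\<Union>a \<in> I i. P a) \<subseteq> Q i" using sub[OF i] by blast
    ultimately show "generated_subcategory D (\<Union>a \<in> I i. P a) \<subseteq> Q i"
      unfolding generated_subcategory_def using tri[OF i] by (intro Inter_lower) simp
    show "Q i \<subseteq> generated_subcategory D (\<Union>a \<in> I i. P a)"
      unfolding generated_subcategory_def
    proof (intro subsetI InterI)
      \<comment> \<open>Any competitor \<open>R\<close> contains the factors of a fine filtration of
        \<open>x\<close>, hence \<open>x\<close>.\<close>
      fix x R assume x: "x \<in> Q i"
        and R: "R \<in> {R. triangulated_subcategory D R \<and> summand_closed D R \<and> (\<Union>a \<in> I i. P a) \<subseteq> R}"
      obtain t where "filtered D P t x" "set t \<subseteq> I i" using filt[OF i x] by blast
      moreover have "triangulated_subcategory D R" "(\<Union>a \<in> I i. P a) \<subseteq> R" using R by simp_all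
      ultimately show "x \<in> R" using filtered_closed[of P t x R] by blast
    qed
  qed
  have r_Idx: "r a \<in> {1..n}" if "a \<in> \<Psi>" for a using PsiE[OF that] r by metis
  have "finer D V T" unfolding finer_def
  proof (intro exI[of _ r] conjI ballI impI)
    have "i \<in> r ` \<Psi>" if i: "i \<in> {1..n}" for i
    proof -
      obtain a where "a \<in> I i" using nonempty[OF i] by blast
      then show ?thesis using r[OF i] Psi i by blast
    qed
    then show "r ` Idx V = Idx T" using r_Idx by auto
    \<comment> \<open>Both automorphisms are trivial, that of \<open>V\<close> by construction and
      that of \<open>T\<close> by finiteness.\<close>
    show "r (Tau V a) = Tau T (r a)" if "a \<in> Idx V" for a
      using finite_t_stability_Tau[OF T, of "r a"] r_Idx that by simp
    show "(r a, r b) \<in> Ord T"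
      if ab: "a \<in> Idx V" "b \<in> Idx V" "below V a b" for a b
    proof -
      obtain i j where ij: "i \<in> {1..n}" "j \<in> {1..n}" "a \<in> I i" "b \<in> I j"
        using PsiE ab(1,2) by (metis V_simps(1))
      then show ?thesis using mono[OF ij ab(3)] r[of i a] r[of j b] by simp
    qed
    show "Part T i = generated_subcategory D (\<Union>a \<in> {a \<in> Idx V. r a = i}. Part V a)"
      if "i \<in> Idx T" for i
      using gen fibre that by simp
  qed
  with fin show ?thesis unfolding T_def V_def by blast
qed

end
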